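(* Let $l\ge 2$, $k>l$ and $m\ge 2$ be integers with $2k\neq ml$. Then, as $n\to\infty$, $$ex(n,C_{ml},\{C_3,C_4,\dots,C_{2l-1}\}\cup\{C_{2k}\})=\Theta(n^m).$$
   Context: $C_k$ denotes the cycle with $k$ vertices. For a graph $H$ and a family of graphs $\mathcal F$, $ex(n,H,\mathcal F)$ is the maximum number of subgraphs isomorphic to $H$ in an $n$-vertex graph containing no member of $\mathcal F$ as a subgraph. *)

theory Defs
  imports Main "HOL-Library.Landau_Symbols"
begin

definition simple_graph :: "nat \<Rightarrow> nat set set \<Rightarrow> bool" where
  "simple_graph n G \<longleftrightarrow> G \<subseteq> {{u, v} | u v. u \<noteq> v \<and> u < n \<and> v < n}"

definition cycle_in :: "nat set set \<Rightarrow> nat \<Rightarrow> (nat \<Rightarrow> nat) \<Rightarrow> bool" where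
  "cycle_in G k f \<longleftrightarrow> k \<ge> 3 \<and> inj_on f {..<k} \<and>
     (\<forall>i<k. {f i, f (Suc i mod k)} \<in> G)"

definition cycle_edges :: "nat \<Rightarrow> (nat \<Rightarrow> nat) \<Rightarrow> nat set set" where
  "cycle_edges k f = {{f i, f (Suc i mod k)} | i. i < k}"

(* Number of subgraphs of G isomorphic to C_k (a copy of C_k is determined by its edge set) *)
definition num_cycles :: "nat set set \<Rightarrow> nat \<Rightarrow> nat" where
  "num_cycles G k = card {cycle_edges k f | f. cycle_in G k f}"

definition contains_cycle :: "nat set set \<Rightarrow> nat \<Rightarrow> bool" where
  "contains_cycle G k \<longleftrightarrow> (\<exists>f. cycle_in G k f)"

definition ex_cycles :: "nat \<Rightarrow> nat \<Rightarrow> nat set \<Rightarrow> nat" where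
  "ex_cycles n k F = Max {num_cycles G k | G. simple_graph n G \<and> (\<forall>j\<in>F. \<not> contains_cycle G j)}"

end

theory Submission
  imports Defs "HOL-Library.FuncSet" "HOL-Number_Theory.Cong" "HOL-Analysis.Convex"
begin

text \<open>
  Let \<open>p x y\<close> be the number of paths of length \<open>l\<close> from \<open>x\<close> to \<open>y\<close>. The number of cycles of length
  \<open>m * l\<close> is at most the trace of the \<open>m\<close>-th power of the matrix \<open>p\<close>, hence by the Cauchy-Schwarz
  inequality at most the \<open>m\<close>-th power of its Frobenius norm. It therefore suffices to bound
  \<open>\<Sum>x y. (p x y)\<^sup>2\<close> by \<open>O(n\<^sup>2)\<close>. Since the girth is at least \<open>2 * l\<close>, distinct paths of length \<open>l\<close>
  with common ends are internally disjoint. Call a pair fat if \<open>p\<close> is at least \<open>2 * k\<close> there. Pairs of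
  paths forming a cycle of length \<open>2 * l\<close> with a prescribed antipodal pair that is not fat are counted
  by rotating the cycle to that pair; there are \<open>O(n\<^sup>2)\<close> of them. If that antipodal pair is fat, a
  greedy argument shows that only \<open>O(p x y)\<close> pairs of paths from \<open>x\<close> to \<open>y\<close> occur, as otherwise fat
  links could be chained to a cycle of length \<open>2 * k\<close>. Finally \<open>\<Sum>y. p x y = O(n)\<close> by an argument in
  the style of Bondy and Simonovits on the breadth-first levels around \<open>x\<close>.

  For the lower bound, arrange \<open>m\<close> hubs cyclically and join consecutive hubs by about \<open>n / (m * l)\<close>
  disjoint paths of length \<open>l\<close>: every cycle has length \<open>2 * l\<close> or \<open>m * l\<close>.
\<close>

subsection \<open>Relations of large minimum degree\<close>

text \<open>Deleting an element of degree at most \<open>D\<close> removes at most \<open>D\<close>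
  pairs and one element of its side, so the strict inequality survives, and with it nonemptiness. An
  element on both sides counts twice.\<close>

lemma min_degree_subrelation:
  fixes E :: "('a \<times> 'a) set"
  assumes "finite E" and "D * (card (Domain E) + card (Range E)) < card E"
  shows "\<exists>F\<subseteq>E. F \<noteq> {} \<and> (\<forall>a\<in>Domain F. D < card (F `` {a}))
    \<and> (\<forall>b\<in>Range F. D < card (F\<inverse> `` {b}))"
  using assms
proof (induction E rule: finite_psubset_induct)
  case (psubset E)
  have fin: "finite (Domain E)" "finite (Range E)"
    using psubset.hyps by (auto simp: finite_Domain finite_Range)
  have step: ?case if E': "E' \<subset> E" "card E \<le> card E' + D"
    "card (Domain E') + card (Range E') < card (Domain E) + card (Range E)" for E'
  proof -
    have "D * (card (Domain E') + card (Range E')) + D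
        \<le> D * (card (Domain E) + card (Range E))"
      using mult_le_mono2[OF Suc_leI[OF E'(3)], of D] by (simp add: algebra_simps)
    then have "D * (card (Domain E') + card (Range E')) < card E'"
      using psubset.prems E'(2) by linarith
    from psubset.IH[OF E'(1) this] obtain F where "F \<subseteq> E'" and F: "F \<noteq> {}"
      "\<forall>a\<in>Domain F. D < card (F `` {a})" "\<forall>b\<in>Range F. D < card (F\<inverse> `` {b})"
      by (elim exE conjE)
    have "F \<subseteq> E" using \<open>F \<subseteq> E'\<close> E'(1) by (rule subset_trans[OF _ psubset_imp_subset])
    then show ?case using F by (intro exI conjI)
  qed
  show ?case
  proof (cases "\<exists>a\<in>Domain E. card (E `` {a}) \<le> D")
    case True
    then obtain a where left: "a \<in> Domain E" "card (E `` {a}) \<le> D" by blast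
    let ?E' = "E - {a} \<times> UNIV"
    have "E = ?E' \<union> Pair a ` (E `` {a})" by auto
    then have "card E \<le> card ?E' + card (Pair a ` (E `` {a}))" by (metis card_Un_le)
    moreover have "card (Pair a ` (E `` {a})) = card (E `` {a})"
      by (intro card_image) (simp add: inj_on_def)
    moreover have "card (Domain ?E') < card (Domain E)"
      using left(1) fin by (intro psubset_card_mono) auto
    moreover have "card (Range ?E') \<le> card (Range E)"
      using fin by (intro card_mono) auto
    moreover have "?E' \<subset> E" using left(1) by auto
    ultimately show ?thesis using left(2) by (intro step[of ?E']) auto
  next
    case no_left: False
    show ?thesis
    proof (cases "\<exists>b\<in>Range E. card (E\<inverse> `` {b}) \<le> D")
      case True
      then obtain b where right: "b \<in> Range E" "card (E\<inverse> `` {b}) \<le> D" by blast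
      let ?E' = "E - UNIV \<times> {b}"
      have "E = ?E' \<union> (\<lambda>a. (a, b)) ` (E\<inverse> `` {b})" by auto
      then have "card E \<le> card ?E' + card ((\<lambda>a. (a, b)) ` (E\<inverse> `` {b}))" by (metis card_Un_le)
      moreover have "card ((\<lambda>a. (a, b)) ` (E\<inverse> `` {b})) = card (E\<inverse> `` {b})"
        by (intro card_image) (simp add: inj_on_def)
      moreover have "card (Range ?E') < card (Range E)"
        using right(1) fin by (intro psubset_card_mono) auto
      moreover have "card (Domain ?E') \<le> card (Domain E)"
        using fin by (intro card_mono) auto
      moreover have "?E' \<subset> E" using right(1) by auto
      ultimately show ?thesis using right(2) by (intro step[of ?E']) auto
    next
      case False
      then show ?thesis
        using psubset.prems no_left by (intro exI[of _ E]) (auto simp: not_le)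
    qed
  qed
qed

text \<open>A path in the bipartite graph of \<open>F\<close> that starts on the left side.
  Distinctness refers to the underlying elements, so none is used once on each side.\<close>

definition zigzag :: "('a \<times> 'a) set \<Rightarrow> 'a list \<Rightarrow> bool" where
  "zigzag F zs \<longleftrightarrow> distinct zs \<and> (\<forall>i. Suc i < length zs \<longrightarrow>
     (if even i then (zs ! i, zs ! Suc i) \<in> F else (zs ! Suc i, zs ! i) \<in> F))"

lemma zigzag_nth_mem:
  assumes "zigzag F zs" "zs ! 0 \<in> Domain F" "i < length zs"
  shows "if even i then zs ! i \<in> Domain F else zs ! i \<in> Range F"
proof (cases i)
  case 0
  then show ?thesis using assms by simp
next
  case (Suc j)
  then have "if even j then (zs ! j, zs ! i) \<in> F else (zs ! i, zs ! j) \<in> F"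
    using assms unfolding zigzag_def by simp
  then show ?thesis using Suc by (auto split: if_splits)
qed

text \<open>Greedy extension: the current end has more than \<open>D\<close> neighbours, while at
  most \<open>D\<close> elements are already used or forbidden. The start itself may lie in
  \<open>S\<close>.\<close>

lemma zigzag_exists:
  fixes F :: "('a \<times> 'a) set"
  assumes deg: "\<forall>a\<in>Domain F. D < card (F `` {a})" "\<forall>b\<in>Range F. D < card (F\<inverse> `` {b})"
    and "a \<in> Domain F" "finite S" "r + card S \<le> D"
  shows "\<exists>zs. length zs = Suc r \<and> zs ! 0 = a \<and> zigzag F zs \<and> set (tl zs) \<inter> S = {}"
  using \<open>r + card S \<le> D\<close>
proof (induction r)
  case 0
  then show ?case by (intro exI[of _ "[a]"]) (simp add: zigzag_def)
next
  case (Suc r)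
  then obtain zs where zs: "length zs = Suc r" "zs ! 0 = a" "zigzag F zs" "set (tl zs) \<inter> S = {}"
    by auto
  define N where "N = (if even r then F `` {zs ! r} else F\<inverse> `` {zs ! r})"
  have "if even r then zs ! r \<in> Domain F else zs ! r \<in> Range F"
    using zigzag_nth_mem[of F zs r] zs \<open>a \<in> Domain F\<close> by simp
  then have "D < card N" using deg unfolding N_def by (auto split: if_splits)
  moreover have "card (set zs \<union> S) \<le> D"
    using card_Un_le[of "set zs" S] card_length[of zs] zs(1) Suc.prems by linarith
  ultimately have "\<not> N \<subseteq> set zs \<union> S"
    using card_mono[of "set zs \<union> S" N] \<open>finite S\<close> by auto
  then obtain z where z: "z \<in> N" "z \<notin> set zs" "z \<notin> S" by auto
  have "zigzag F (zs @ [z])"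
    unfolding zigzag_def
  proof (intro conjI allI impI)
    show "distinct (zs @ [z])" using zs(3) z(2) by (simp add: zigzag_def)
    fix i assume i: "Suc i < length (zs @ [z])"
    show "if even i then ((zs @ [z]) ! i, (zs @ [z]) ! Suc i) \<in> F
      else ((zs @ [z]) ! Suc i, (zs @ [z]) ! i) \<in> F"
    proof (cases "i = r")
      case True
      then show ?thesis using z(1) zs(1) by (simp add: N_def nth_append split: if_splits)
    next
      case False
      then have "Suc i < length zs" using i zs(1) by simp
      then show ?thesis using zs(3) by (simp add: zigzag_def nth_append)
    qed
  qed
  moreover have "tl (zs @ [z]) = tl zs @ [z]" using zs(1) by (cases zs) auto
  ultimately show ?case
    using zs z by (intro exI[of _ "zs @ [z]"]) (auto simp: nth_append)
qed

subsection \<open>Paths and cycles\<close>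

definition path :: "nat set set \<Rightarrow> nat list \<Rightarrow> bool" where
  "path G p \<longleftrightarrow> distinct p \<and> successively (\<lambda>u v. {u, v} \<in> G) p"

definition lpaths :: "nat set set \<Rightarrow> nat \<Rightarrow> nat \<Rightarrow> nat \<Rightarrow> nat list set" where
  "lpaths G a u v = {p. path G p \<and> length p = Suc a \<and> p ! 0 = u \<and> p ! a = v}"

lemma lpathsD:
  assumes "p \<in> lpaths G a u v"
  shows "path G p" "distinct p" "length p = Suc a" "p ! 0 = u" "p ! a = v"
  using assms by (auto simp: lpaths_def path_def)

lemma path_rev: "path G p \<Longrightarrow> path G (rev p)"
  by (simp add: path_def insert_commute)

lemma path_appendD: "path G (p @ q) \<Longrightarrow> path G p \<and> path G q"
  by (auto simp: path_def successively_append_iff)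

lemma lpaths_rev: "p \<in> lpaths G a u v \<Longrightarrow> rev p \<in> lpaths G a v u"
  by (auto simp: lpaths_def path_rev rev_nth)

lemma lpaths_take:
  assumes "p \<in> lpaths G a u v" "i \<le> a"
  shows "take (Suc i) p \<in> lpaths G i u (p ! i)"
proof -
  have "path G (take (Suc i) p)"
    using path_appendD[of G "take (Suc i) p" "drop (Suc i) p"] lpathsD[OF assms(1)] by simp
  then show ?thesis using lpathsD[OF assms(1)] assms(2) by (auto simp: lpaths_def)
qed

lemma lpaths_drop:
  assumes "p \<in> lpaths G a u v" "i \<le> a"
  shows "drop i p \<in> lpaths G (a - i) (p ! i) v"
proof -
  have "path G (drop i p)"
    using path_appendD[of G "take i p" "drop i p"] lpathsD[OF assms(1)] by simp
  then show ?thesis using lpathsD[OF assms(1)] assms(2) by (auto simp: lpaths_def)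
qed

lemma lpaths_append:
  assumes p: "p \<in> lpaths G a u v" and q: "q \<in> lpaths G b v w"
    and disj: "set p \<inter> set (tl q) = {}"
  shows "p @ tl q \<in> lpaths G (a + b) u w"
proof -
  note P = lpathsD[OF p] and Q = lpathsD[OF q]
  obtain q' where q': "q = v # q'" using Q by (cases q) auto
  have "p \<noteq> []" using P(3) by (metis list.size(3) nat.distinct(1))
  moreover from this have "last p = v" using P by (simp add: last_conv_nth)
  ultimately have last: "p \<noteq> []" "last p = v" by simp_all
  have "path G (p @ q')"
    using P(1) Q(1) disj last unfolding path_def q'
    by (auto simp: successively_append_iff successively_Cons)
  moreover have "(p @ q') ! (a + b) = w"
    using P Q q' by (cases b) (auto simp: nth_append)
  ultimately show ?thesis using P Q q' by (auto simp: lpaths_def nth_append)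
qed

lemma lpaths_edge:
  assumes "p \<in> lpaths G a u v" "i < a"
  shows "{p ! i, p ! Suc i} \<in> G"
  using lpathsD[OF assms(1)] assms(2) unfolding path_def by (auto simp: successively_conv_nth)

lemma set_take_nth: "i < length p \<Longrightarrow> set (take (Suc i) p) = (!) p ` {..i}"
  using nth_image[of "Suc i" p] by (simp add: lessThan_Suc_atMost atLeast0LessThan)

lemma set_drop_nth: "set (drop i p) = (!) p ` {i..<length p}"
proof (cases "i \<le> length p")
  case True
  have "set (drop i p) = (\<lambda>j. p ! (i + j)) ` {0..<length p - i}"
    using True nth_image[of "length (drop i p)" "drop i p"] by (auto simp: image_iff)
  also have "\<dots> = (!) p ` ((+) i ` {0..<length p - i})" by (simp only: image_image)
  also have "(+) i ` {0..<length p - i} = {i..<length p}" using True by simp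
  finally show ?thesis .
qed simp

lemma contains_cycleI:
  assumes "path G p" "length p = k" "k \<ge> 3" "{last p, hd p} \<in> G"
  shows "contains_cycle G k"
proof -
  have "p \<noteq> []" using assms by auto
  have "{p ! i, p ! (Suc i mod k)} \<in> G" if "i < k" for i
  proof (cases "Suc i = k")
    case True
    then have "last p = p ! i" "hd p = p ! 0"
      using assms \<open>p \<noteq> []\<close> by (auto simp: last_conv_nth hd_conv_nth)
    then show ?thesis using True assms(4) by simp
  next
    case False
    then show ?thesis using that assms by (simp add: path_def successively_conv_nth)
  qed
  moreover have "inj_on ((!) p) {..<k}"
    using assms by (intro inj_on_nth) (auto simp: path_def)
  ultimately show ?thesis
    unfolding contains_cycle_def cycle_in_def using assms(3) by blast
qed

lemma two_paths_cycle:
  assumes p: "p \<in> lpaths G a u v" and q: "q \<in> lpaths G b u v"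
    and "u \<noteq> v" "set p \<inter> set q \<subseteq> {u, v}" "a + b \<ge> 3"
  shows "contains_cycle G (a + b)"
proof -
  note P = lpathsD[OF p] and Q = lpathsD[OF q]
  have "b \<noteq> 0" using Q \<open>u \<noteq> v\<close> by metis
  \<comment> \<open>Return from \<open>v\<close> along \<open>q\<close> but stop at
    \<open>q ! 1\<close>; the edge from there to \<open>u\<close> closes the cycle.\<close>
  have r: "rev (tl q) \<in> lpaths G (b - 1) v (q ! 1)"
    using lpaths_rev[OF lpaths_drop[OF q, of 1]] \<open>b \<noteq> 0\<close> by (simp add: drop_Suc)
  obtain w where w: "rev (tl q) = v # w"
    using lpathsD[OF r] by (cases "rev (tl q)") auto
  have "u \<notin> set (tl q)" "set (tl q) \<subseteq> set q" using Q by (cases q; auto)+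
  moreover have "set (tl q) = insert v (set w)" using w by (metis list.simps(15) set_rev)
  moreover have "v \<notin> set w" using lpathsD(2)[OF r] w by simp
  ultimately have "set (tl (rev (tl q))) \<subseteq> set q - {u, v}" using w by auto
  then have "set p \<inter> set (tl (rev (tl q))) = {}" using assms(4) by blast
  from lpaths_append[OF p r this]
  have c: "p @ tl (rev (tl q)) \<in> lpaths G (a + b - 1) u (q ! 1)" using \<open>b \<noteq> 0\<close> by simp
  have "{q ! 1, u} \<in> G" using lpaths_edge[OF q, of 0] \<open>b \<noteq> 0\<close> Q by (simp add: insert_commute)
  moreover have "p \<noteq> []" using P(3) by auto
  ultimately show ?thesis
    using lpathsD[OF c] assms(5)
    by (intro contains_cycleI[OF lpathsD(1)[OF c]])
       (simp_all add: last_conv_nth[of "p @ tl (rev (tl q))"] hd_conv_nth del: length_append)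
qed

lemma set_lpaths: "p \<in> lpaths G a u v \<Longrightarrow> set p = (!) p ` {..a}"
  using set_take_nth[of a p] by (simp add: lpathsD(3))

lemma set_take_lpaths:
  "p \<in> lpaths G a u v \<Longrightarrow> i \<le> a \<Longrightarrow> set (take (Suc i) p) = (!) p ` {..i}"
  by (simp add: lpathsD(3) set_take_nth)

lemma set_drop_lpaths: "p \<in> lpaths G a u v \<Longrightarrow> set (drop i p) = (!) p ` {i..a}"
  by (simp add: lpathsD(3) set_drop_nth atLeastLessThanSuc_atLeastAtMost)

subsection \<open>Graphs of girth at least 2l\<close>

locale girth_graph =
  fixes G :: "nat set set" and n l :: nat
  assumes simple: "simple_graph n G" and l_ge_2: "l \<ge> 2"
    and girth: "\<And>j. 3 \<le> j \<Longrightarrow> j \<le> 2 * l - 1 \<Longrightarrow> \<not> contains_cycle G j"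
begin

text \<open>Once common initial edges are stripped, different paths with the same ends leave
  \<open>u\<close> along different edges, and the first later vertex of \<open>p\<close> on the
  other path closes a cycle. The bound on the vertices leaves at most \<open>2 * l - 1\<close>
  edges, so that cycle is forbidden.\<close>

lemma path_unique:
  assumes "path G p" "path G q" "p \<noteq> []" "q \<noteq> []" "hd p = hd q" "last p = last q"
    and "length p + length q \<le> 2 * l + 1"
  shows "p = q"
  using assms
proof (induction p arbitrary: q)
  case Nil
  then show ?case by simp
next
  case (Cons u p)
  then obtain q' where q: "q = u # q'" by (cases q) auto
  have dist: "u \<notin> set p" "u \<notin> set q'" using Cons.prems(1,2) q by (auto simp: path_def)
  show ?case
  proof (cases "p = [] \<or> q' = []")
    case True
    then show ?thesis using Cons.prems q dist
      by (metis last_ConsL last_ConsR last_in_set)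
  next
    case False
    then have ne: "p \<noteq> []" "q' \<noteq> []" by auto
    have paths: "path G p" "path G q'"
      using path_appendD[of G "[u]" p] path_appendD[of G "[u]" q'] Cons.prems q by auto
    have last: "last p = last q'" using Cons.prems(6) q ne by simp
    show ?thesis
    proof (cases "hd p = hd q'")
      case True
      have "p = q'"
        using Cons.IH[of q'] paths ne last True Cons.prems(7) q by simp
      then show ?thesis using q by simp
    next
      case False
      have "\<exists>x\<in>set p. x \<in> set q'" using last ne by (metis last_in_set)
      then obtain a v c where a: "p = a @ v # c" "v \<in> set q'" "\<forall>x\<in>set a. x \<notin> set q'"
        using split_list_first_prop[of p "\<lambda>x. x \<in> set q'"] by blast
      obtain b d where b: "q' = b @ v # d" using split_list[OF a(2)] by blast
      have "path G ((u # a @ [v]) @ c)" "path G ((u # b @ [v]) @ d)"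
        using Cons.prems(1,2) q a b by simp_all
      then have "path G (u # a @ [v])" "path G (u # b @ [v])" using path_appendD by blast+
      then have P: "u # a @ [v] \<in> lpaths G (Suc (length a)) u v"
        and Q: "u # b @ [v] \<in> lpaths G (Suc (length b)) u v"
        by (simp_all add: lpaths_def)
      have "a \<noteq> [] \<or> b \<noteq> []" using False a b by auto
      then have "Suc (length a) + Suc (length b) \<ge> 3" by (cases a; cases b) auto
      moreover have "set (u # a @ [v]) \<inter> set (u # b @ [v]) \<subseteq> {u, v}" using a b by auto
      moreover have "u \<noteq> v" using dist a by auto
      ultimately have "contains_cycle G (Suc (length a) + Suc (length b))"
        using two_paths_cycle[OF P Q] by blast
      moreover have "Suc (length a) + Suc (length b) \<le> 2 * l - 1"
        using Cons.prems(7) q a b by simp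
      ultimately show ?thesis using girth \<open>_ \<ge> 3\<close> by blast
    qed
  qed
qed

lemma lpaths_unique:
  assumes p: "p \<in> lpaths G a u v" and q: "q \<in> lpaths G b u v" and "a + b < 2 * l"
  shows "p = q" "a = b"
proof -
  note P = lpathsD[OF p] and Q = lpathsD[OF q]
  have "p \<noteq> []" "q \<noteq> []" using P(3) Q(3) by auto
  then show "p = q"
    using P Q assms(3) by (intro path_unique) (simp_all add: hd_conv_nth last_conv_nth)
  then show "a = b" using P(3) Q(3) by simp
qed

text \<open>The initial segments up to the common vertex have the same ends and total length
  \<open>i + j\<close>, so uniqueness makes them equal.\<close>

lemma lpaths_meet:
  assumes p: "p \<in> lpaths G a u v" and q: "q \<in> lpaths G b u w"
    and "i \<le> a" "j \<le> b" "i + j < 2 * l" "p ! i = q ! j"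
  shows "i = j" "take (Suc i) p = take (Suc i) q"
  using lpaths_unique[OF lpaths_take[OF p, of i], of "take (Suc j) q" j]
    lpaths_take[OF q, of j] assms by auto

text \<open>At any other meeting point the two initial segments, and likewise the two final ones,
  would have total length below \<open>2 * l\<close>, hence coincide.\<close>

lemma lpaths_internally_disjoint:
  assumes p: "p \<in> lpaths G l u v" and q: "q \<in> lpaths G l u v"
    and "p \<noteq> q" "i \<le> l" "j \<le> l" "p ! i = q ! j"
  shows "i = 0 \<and> j = 0 \<or> i = l \<and> j = l"
proof (rule ccontr)
  assume *: "\<not> ?thesis"
  have 1: "i = j" "take (Suc i) p = take (Suc i) q"
    using lpaths_meet[OF p q, of i j] assms * by linarith+
  have "drop i p = drop j q"
    using lpaths_unique(1)[OF lpaths_drop[OF p, of i], of "drop j q" "l - j"]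
      lpaths_drop[OF q, of j] assms * 1 by fastforce
  then have "take i p @ drop i p = take i q @ drop i q"
    using 1 by (metis diff_Suc_Suc minus_nat.diff_0 take_take min.absorb1 le_add2 plus_1_eq_Suc)
  then show False using \<open>p \<noteq> q\<close> by simp
qed

lemma edge_less: "{u, v} \<in> G \<Longrightarrow> u < n"
  using simple unfolding simple_graph_def by (auto simp: doubleton_eq_iff)

lemma lpaths_less:
  assumes "p \<in> lpaths G a u v" "a \<ge> 1" "i \<le> a"
  shows "p ! i < n"
proof (cases "i = a")
  case True
  have "{p ! a, p ! (a - 1)} \<in> G"
    using lpaths_edge[OF assms(1), of "a - 1"] assms(2) by (simp add: insert_commute)
  then show ?thesis using True edge_less by blast
next
  case False
  then show ?thesis using lpaths_edge[OF assms(1), of i] assms(3) edge_less by force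
qed

lemma lpaths_subset_lists:
  "a \<ge> 1 \<Longrightarrow> lpaths G a u v \<subseteq> {xs. set xs \<subseteq> {..<n} \<and> length xs = Suc a}"
  using lpaths_less by (auto simp: set_lpaths lpathsD(3))

definition paths_from :: "nat \<Rightarrow> nat list set" where
  "paths_from x = (\<Union>v. lpaths G l x v)"

lemma finite_paths_from: "finite (paths_from x)"
proof (rule finite_subset)
  show "paths_from x \<subseteq> {xs. set xs \<subseteq> {..<n} \<and> length xs = Suc l}"
    unfolding paths_from_def using lpaths_subset_lists[of l x] l_ge_2 by (intro UN_least) simp
qed (simp add: finite_lists_length_eq)

lemma finite_lpaths: "finite (lpaths G l u v)"
  by (rule finite_subset[OF _ finite_paths_from[of u]]) (auto simp: paths_from_def)

end

subsection \<open>The number of paths of length l\<close>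

locale even_cycle_free_graph = girth_graph +
  fixes k :: nat
  assumes k_gt_l: "k > l" and no_even_cycle: "\<not> contains_cycle G (2 * k)"
begin

text \<open>Otherwise the bipartite graph between the last two levels below \<open>x\<close> has a subgraph \<open>F\<close> of large
  minimum degree. Let \<open>t\<close> be the first level at which two \<open>F\<close>-neighbours \<open>v, v'\<close> of some \<open>y\<close> have
  different ancestors, and follow \<open>F\<close> from a third neighbour \<open>b\<close> of \<open>y\<close> to a vertex \<open>z\<close>. The ancestor
  of \<open>z\<close> at level \<open>t\<close> differs from that of \<open>v\<close> or \<open>v'\<close>, so the path through \<open>y\<close> and \<open>b\<close> closes up in
  the tree, which branches exactly at level \<open>t - 1\<close>.\<close>

lemma card_paths_from: "card (paths_from x) \<le> (2 * k + 1) * (2 * n)"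
proof (rule ccontr)
  assume big: "\<not> ?thesis"
  let ?D = "2 * k + 1"
  define E where "E = (\<lambda>p. (p ! (l - 1), p ! l)) ` paths_from x"
  have fromD: "p \<in> lpaths G l x (p ! l)" if "p \<in> paths_from x" for p
    using that by (auto simp: paths_from_def lpaths_def)
  \<comment> \<open>By the girth, the vertex at level \<open>l - 1\<close> determines the path up to
    it, so the last edge determines the whole path.\<close>
  have "inj_on (\<lambda>p. (p ! (l - 1), p ! l)) (paths_from x)"
  proof (rule inj_onI)
    fix p q assume p: "p \<in> paths_from x" and q: "q \<in> paths_from x"
      and eq: "(p ! (l - 1), p ! l) = (q ! (l - 1), q ! l)"
    have "take (Suc (l - 1)) p = take (Suc (l - 1)) q"
      using lpaths_meet(2)[OF fromD[OF p] fromD[OF q], of "l - 1" "l - 1"] eq l_ge_2 by simp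
    moreover have "p = take l p @ [p ! l]" "q = take l q @ [q ! l]"
      using lpathsD(3)[OF fromD[OF p]] lpathsD(3)[OF fromD[OF q]]
      by (metis lessI take_Suc_conv_app_nth take_all order_refl)+
    ultimately show "p = q" using eq l_ge_2 by simp
  qed
  then have card_E: "card E = card (paths_from x)" unfolding E_def by (rule card_image)
  have finE: "finite E" unfolding E_def using finite_paths_from by simp
  have "Domain E \<subseteq> {..<n}" "Range E \<subseteq> {..<n}"
    unfolding E_def using lpaths_less[OF fromD] l_ge_2 by auto
  then have "card (Domain E) \<le> n" "card (Range E) \<le> n"
    by (metis card_lessThan card_mono finite_lessThan)+
  then have "?D * (card (Domain E) + card (Range E)) \<le> ?D * (2 * n)"
    by (intro mult_le_mono2) simp
  then have "?D * (card (Domain E) + card (Range E)) < card E"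
    using big card_E by linarith
  from min_degree_subrelation[OF finE this] obtain F where "F \<subseteq> E" and ne: "F \<noteq> {}"
    and degD: "\<forall>a\<in>Domain F. ?D < card (F `` {a})"
    and degR: "\<forall>b\<in>Range F. ?D < card (F\<inverse> `` {b})"
    by (elim exE conjE)

  \<comment> \<open>The paths \<open>tp v\<close> form the tree below \<open>x\<close> down to level
    \<open>l - 1\<close>; the girth makes each of them unique.\<close>
  have "\<exists>q. q \<in> lpaths G (l - 1) x v" if v: "v \<in> Domain F" for v
  proof -
    obtain y where "(v, y) \<in> E" using v \<open>F \<subseteq> E\<close> by auto
    then obtain p where p: "p \<in> paths_from x" "v = p ! (l - 1)" unfolding E_def by auto
    show ?thesis using lpaths_take[OF fromD[OF p(1)], of "l - 1"] p(2) by auto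
  qed
  then obtain tp where tp: "\<And>v. v \<in> Domain F \<Longrightarrow> tp v \<in> lpaths G (l - 1) x v" by metis
  \<comment> \<open>Levels are well defined, so a tree path \<open>tp u\<close> meets the vertices
    of \<open>F\<close> only in its end \<open>u\<close>. This later keeps the two halves of the
    cycle apart.\<close>
  have X_tp: "u = v" if "u \<in> Domain F" "v \<in> Domain F" "i < l" "tp u ! i = v" for u v i
  proof -
    have "tp u ! i = tp v ! (l - 1)" using that lpathsD(5)[OF tp] by simp
    then have "i = l - 1"
      using lpaths_meet(1)[OF tp[OF that(1)] tp[OF that(2)], of i "l - 1"] that(3) by simp
    then show ?thesis using that lpathsD(5)[OF tp] by simp
  qed
  have Y_tp: "tp u ! i \<noteq> y" if u: "u \<in> Domain F" and y: "y \<in> Range F" and "i < l" for u y i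
  proof
    assume eq: "tp u ! i = y"
    obtain v where "(v, y) \<in> E" using y \<open>F \<subseteq> E\<close> by auto
    then obtain p where p: "p \<in> paths_from x" "y = p ! l" unfolding E_def by auto
    show False
      using lpaths_meet(1)[OF tp[OF that(1)] fromD[OF p(1)], of i l] that(3) eq p(2) by fastforce
  qed
  have edge: "{a, b} \<in> G" if "(a, b) \<in> F" for a b
  proof -
    have "(a, b) \<in> E" using that \<open>F \<subseteq> E\<close> by auto
    then obtain p where p: "p \<in> paths_from x" "a = p ! (l - 1)" "b = p ! l"
      unfolding E_def by auto
    show ?thesis using lpaths_edge[OF fromD[OF p(1)], of "l - 1"] l_ge_2 p by simp
  qed

  define S where "S t \<longleftrightarrow> (\<exists>y v v'. (v, y) \<in> F \<and> (v', y) \<in> F \<and> tp v ! t \<noteq> tp v' ! t)" for t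
  have "S (l - 1)"
  proof -
    obtain v y where vy: "(v, y) \<in> F" using ne by auto
    then have "?D < card (F\<inverse> `` {y})" using degR by auto
    then have "\<not> F\<inverse> `` {y} \<subseteq> {v}" using card_mono[of "{v}" "F\<inverse> `` {y}"] by auto
    then obtain v' where v': "(v', y) \<in> F" "v' \<noteq> v" by auto
    have "tp v ! (l - 1) = v" "tp v' ! (l - 1) = v'" using lpathsD(5)[OF tp] vy v' by auto
    then show ?thesis unfolding S_def using vy v' by metis
  qed
  define t where "t = (LEAST t. S t)"
  have "S t" unfolding t_def using \<open>S (l - 1)\<close> by (rule LeastI)
  have "t \<le> l - 1" unfolding t_def using \<open>S (l - 1)\<close> by (rule Least_le)
  have "t \<noteq> 0"
  proof
    assume "t = 0"
    with \<open>S t\<close> show False unfolding S_def using lpathsD(4)[OF tp] by (metis DomainI)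
  qed
  have "\<not> S (t - 1)" using not_less_Least[of "t - 1" S] \<open>t \<noteq> 0\<close> unfolding t_def by simp
  then have agree: "tp v ! (t - 1) = tp v' ! (t - 1)" if "(v, y) \<in> F" "(v', y) \<in> F" for v v' y
    using that unfolding S_def by blast
  obtain y v v' where y: "(v, y) \<in> F" "(v', y) \<in> F" "tp v ! t \<noteq> tp v' ! t"
    using \<open>S t\<close> unfolding S_def by blast
  have "?D < card (F\<inverse> `` {y})" using degR y by auto
  moreover have "card {v, v'} \<le> 2" by (simp add: card_insert_if)
  ultimately have "\<not> F\<inverse> `` {y} \<subseteq> {v, v'}"
    using card_mono[of "{v, v'}" "F\<inverse> `` {y}"] k_gt_l l_ge_2 by auto
  then obtain b where b: "(b, y) \<in> F" "b \<noteq> v" "b \<noteq> v'" by auto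

  \<comment> \<open>The path \<open>W\<close> will have \<open>2 * q\<close> edges and the return
    through the tree \<open>2 * (l - t)\<close>, which add up to \<open>2 * k\<close>.\<close>
  define q where "q = k - l + t"
  have q: "2 \<le> q" "q \<le> k" "q + l = k + t"
    using \<open>t \<noteq> 0\<close> \<open>t \<le> l - 1\<close> k_gt_l l_ge_2 unfolding q_def by auto
  \<comment> \<open>At most \<open>2 * k - 2\<close> steps and three forbidden vertices: this is the
    source of the degree bound \<open>2 * k + 1\<close>.\<close>
  have "card {y, v, v'} \<le> 3" by (simp add: card_insert_if)
  then have "2 * q - 2 + card {y, v, v'} \<le> ?D" using q by linarith
  then obtain zs where zs: "length zs = Suc (2 * q - 2)" "zs ! 0 = b" "zigzag F zs"
      "set (tl zs) \<inter> {y, v, v'} = {}"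
    using zigzag_exists[OF degD degR, of b "{y, v, v'}" "2 * q - 2"] b by auto
  define z where "z = zs ! (2 * q - 2)"
  obtain r where r: "r = v \<or> r = v'" "tp r ! t \<noteq> tp z ! t" using y(3) by metis
  have ry: "(r, y) \<in> F" using r y by auto
  have "b \<in> Domain F" using b by auto
  have zs_mem: "if even i then zs ! i \<in> Domain F else zs ! i \<in> Range F"
    if "i < length zs" for i
    using zigzag_nth_mem[OF zs(3) _ that] zs(2) \<open>b \<in> Domain F\<close> by simp
  have zD: "z \<in> Domain F" using zs_mem[of "2 * q - 2"] zs(1) unfolding z_def by simp
  have rD: "r \<in> Domain F" using ry by auto

  \<comment> \<open>Consecutive left vertices of the zigzag share a right neighbour, so by
    minimality of \<open>t\<close> their ancestors at level \<open>t - 1\<close> agree.\<close>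
  have anc: "tp (zs ! (2 * i)) ! (t - 1) = tp b ! (t - 1)" if "2 * i < length zs" for i
    using that
  proof (induction i)
    case 0
    then show ?case using zs by simp
  next
    case (Suc i)
    have "(zs ! (2 * i), zs ! Suc (2 * i)) \<in> F" "(zs ! Suc (Suc (2 * i)), zs ! Suc (2 * i)) \<in> F"
      using zs(3) Suc.prems unfolding zigzag_def
      by (auto dest: spec[of _ "2 * i"] spec[of _ "Suc (2 * i)"])
    from agree[OF this] Suc show ?case by simp
  qed
  have anc_rz: "tp r ! (t - 1) = tp z ! (t - 1)"
    using anc[of "q - 1"] zs(1) agree[OF ry b(1)] unfolding z_def by (simp add: right_diff_distrib')

  have zs_set: "set zs = insert b (set (tl zs))" using zs(1,2) by (cases zs) auto
  have loop: "a \<noteq> c" if "(a, c) \<in> F" for a c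
    using edge[OF that] simple unfolding simple_graph_def by (auto simp: doubleton_eq_iff)
  define W where "W = r # y # zs"
  have "distinct W"
    unfolding W_def using zs zs_set r b loop[OF ry] loop[OF b(1)] by (auto simp: zigzag_def)
  have "successively (\<lambda>u v. {u, v} \<in> G) zs"
  proof -
    have "{zs ! i, zs ! Suc i} \<in> G" if "Suc i < length zs" for i
    proof (cases "even i")
      case True
      then show ?thesis using zs(3) that edge unfolding zigzag_def by simp
    next
      case False
      then show ?thesis using zs(3) that edge[of "zs ! Suc i" "zs ! i"] unfolding zigzag_def
        by (simp add: insert_commute)
    qed
    then show ?thesis by (simp add: successively_conv_nth)
  qed
  moreover have "{r, y} \<in> G" "{y, hd zs} \<in> G" "zs \<noteq> []"
    using edge[OF ry] edge[OF b(1)] zs(1,2) by (cases zs; simp add: insert_commute)+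
  ultimately have "path G W"
    using \<open>distinct W\<close> unfolding path_def W_def by (simp add: successively_Cons)
  moreover have "length W = Suc (2 * q)" using zs(1) q(1) unfolding W_def by simp
  moreover have "W ! (2 * q) = z"
    using q(1) unfolding W_def z_def by (simp add: nth_Cons' numeral_2_eq_2)
  ultimately have W: "W \<in> lpaths G (2 * q) r z" unfolding lpaths_def by (simp add: W_def)

  have R: "rev (drop (t - 1) (tp r)) \<in> lpaths G (l - t) r (tp r ! (t - 1))"
    using lpaths_rev[OF lpaths_drop[OF tp[OF rD], of "t - 1"]] \<open>t \<le> l - 1\<close> \<open>t \<noteq> 0\<close> by simp
  have Z: "drop (t - 1) (tp z) \<in> lpaths G (l - t) (tp r ! (t - 1)) z"
    using lpaths_drop[OF tp[OF zD], of "t - 1"] \<open>t \<le> l - 1\<close> \<open>t \<noteq> 0\<close> anc_rz by simp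
  have tlZ: "tl (drop (t - 1) (tp z)) = drop t (tp z)"
    using \<open>t \<noteq> 0\<close> by (simp add: drop_Suc tl_drop flip: drop_Suc)
  have setR: "set (rev (drop (t - 1) (tp r))) = (!) (tp r) ` {t - 1..l - 1}"
    using set_drop_lpaths[OF tp[OF rD]] by simp
  have setZ: "set (drop t (tp z)) = (!) (tp z) ` {t..l - 1}"
    using set_drop_lpaths[OF tp[OF zD]] by simp
  \<comment> \<open>A meeting at level \<open>t\<close> or deeper would force the tree paths to
    agree at level \<open>t\<close>, against the choice of \<open>r\<close>.\<close>
  have "tp r ! i \<noteq> tp z ! j" if "i \<le> l - 1" "t \<le> j" "j \<le> l - 1" for i j
  proof
    assume eq: "tp r ! i = tp z ! j"
    then have "i = j" "take (Suc i) (tp r) = take (Suc i) (tp z)"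
      using lpaths_meet[OF tp[OF rD] tp[OF zD], of i j] that l_ge_2 by simp_all
    then have "tp r ! t = tp z ! t"
      using that by (metis le_imp_less_Suc nth_take)
    then show False using r(2) by simp
  qed
  then have disj: "set (rev (drop (t - 1) (tp r))) \<inter> set (tl (drop (t - 1) (tp z))) = {}"
    unfolding tlZ setR setZ by auto
  define C where "C = rev (drop (t - 1) (tp r)) @ drop t (tp z)"
  have C: "C \<in> lpaths G (2 * (l - t)) r z"
    using lpaths_append[OF R Z disj] unfolding tlZ C_def by (simp add: mult_2)
  have "set W \<inter> set C \<subseteq> {r, z}"
  proof
    fix w assume w: "w \<in> set W \<inter> set C"
    then have "w \<in> (!) (tp r) ` {..l - 1} \<or> w \<in> (!) (tp z) ` {..l - 1}"
      using setR setZ unfolding C_def by auto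
    then obtain i where "i \<le> l - 1" "w = tp r ! i \<or> w = tp z ! i" by auto
    then have i: "i < l" "w = tp r ! i \<or> w = tp z ! i" using l_ge_2 by auto
    have "w \<in> Domain F \<or> w \<in> Range F"
    proof -
      have "w = r \<or> w = y \<or> w \<in> set zs" using w unfolding W_def by auto
      then show ?thesis using zs_mem ry by (metis Domain.DomainI Range.intros in_set_conv_nth)
    qed
    then show "w \<in> {r, z}"
    proof
      assume "w \<in> Domain F"
      then show ?thesis using i X_tp[OF rD _ i(1), of w] X_tp[OF zD _ i(1), of w] by auto
    next
      assume "w \<in> Range F"
      then show ?thesis using i Y_tp[OF rD _ i(1), of w] Y_tp[OF zD _ i(1), of w] by auto
    qed
  qed
  moreover have "r \<noteq> z" using r(2) by auto
  moreover have "2 * q + 2 * (l - t) = 2 * k" using q(3) \<open>t \<le> l - 1\<close> l_ge_2 by simp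
  ultimately show False
    using two_paths_cycle[OF W C] no_even_cycle k_gt_l l_ge_2 by simp
qed

end

subsection \<open>The number of cycles of length 2l\<close>

context girth_graph
begin

abbreviation num_paths :: "nat \<Rightarrow> nat \<Rightarrow> nat" where
  "num_paths u v \<equiv> card (lpaths G l u v)"

lemma num_paths_commute: "num_paths u v = num_paths v u"
proof -
  have "rev ` lpaths G l u v = lpaths G l v u"
    using lpaths_rev by (auto simp: image_iff) (metis rev_rev_ident)
  then show ?thesis using card_image[of rev "lpaths G l u v"] by (simp add: inj_on_def)
qed

text \<open>By internal disjointness each vertex of \<open>S\<close> blocks at most one
  path.\<close>

lemma lpath_avoiding:
  assumes "finite S" "card S < num_paths u v"
  shows "\<exists>p\<in>lpaths G l u v. \<forall>i. 0 < i \<longrightarrow> i < l \<longrightarrow> p ! i \<notin> S"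
proof (rule ccontr)
  assume "\<not> ?thesis"
  then have "\<forall>p\<in>lpaths G l u v. \<exists>i. 0 < i \<and> i < l \<and> p ! i \<in> S" by blast
  then obtain f where f: "\<And>p. p \<in> lpaths G l u v \<Longrightarrow> 0 < f p \<and> f p < l \<and> p ! f p \<in> S"
    by metis
  have "inj_on (\<lambda>p. p ! f p) (lpaths G l u v)"
  proof (rule inj_onI, rule ccontr)
    fix p q assume p: "p \<in> lpaths G l u v" and q: "q \<in> lpaths G l u v"
      and "p ! f p = q ! f q" "p \<noteq> q"
    then show False
      using lpaths_internally_disjoint[OF p q, of "f p" "f q"] f[OF p] f[OF q] by auto
  qed
  moreover have "(\<lambda>p. p ! f p) ` lpaths G l u v \<subseteq> S" using f by auto
  ultimately have "num_paths u v \<le> card S" using card_inj_on_le assms(1) by blast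
  then show False using assms(2) by simp
qed

text \<open>Links are added greedily, each avoiding \<open>S\<close> and the path so far. The
  induction puts the next waypoint \<open>w (Suc r)\<close> into \<open>S\<close>, so that earlier
  links do not run through it.\<close>

lemma chain_avoiding:
  assumes "\<And>i. i < r \<Longrightarrow> T \<le> num_paths (w i) (w (Suc i))" "inj_on w {..r}"
    and "finite S" "w ` {..r} \<inter> S = {}" "card S + r * l + 1 \<le> T"
  shows "\<exists>p\<in>lpaths G (r * l) (w 0) (w r). set p \<inter> S = {}"
  using assms
proof (induction r arbitrary: S)
  case 0
  then show ?case by (intro bexI[of _ "[w 0]"]) (auto simp: lpaths_def path_def)
next
  case (Suc r)
  have inj: "inj_on w {..r}" by (rule inj_on_subset[OF Suc.prems(2)]) auto
  have "w (Suc r) \<notin> w ` {..r}" using Suc.prems(2) by (force simp: inj_on_def)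
  then have disj: "w ` {..r} \<inter> insert (w (Suc r)) S = {}"
    using Suc.prems(4) by (auto simp: atMost_Suc)
  have "card (insert (w (Suc r)) S) + r * l + 1 \<le> T"
    using Suc.prems(3,5) l_ge_2 by (simp add: card_insert_if)
  from Suc.IH[OF Suc.prems(1)[OF less_SucI] inj _ disj this]
  obtain p where p: "p \<in> lpaths G (r * l) (w 0) (w r)"
      "set p \<inter> insert (w (Suc r)) S = {}"
    using Suc.prems(3) by auto
  have "card (S \<union> set p) \<le> card S + Suc (r * l)"
    using card_Un_le[of S "set p"] card_length[of p] lpathsD(3)[OF p(1)] by linarith
  then have "card (S \<union> set p) < num_paths (w r) (w (Suc r))"
    using Suc.prems(1)[of r] Suc.prems(5) l_ge_2 by simp
  from lpath_avoiding[OF _ this] obtain q where q: "q \<in> lpaths G l (w r) (w (Suc r))"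
    "\<And>i. 0 < i \<Longrightarrow> i < l \<Longrightarrow> q ! i \<notin> S \<union> set p"
    using Suc.prems(3) by auto
  have "set (tl q) = (!) q ` {1..l}" using set_drop_lpaths[OF q(1), of 1] by (simp add: drop_Suc)
  moreover have "q ! i \<notin> S \<union> set p" if "i \<in> {1..l}" for i
  proof (cases "i = l")
    case True
    then show ?thesis using lpathsD(5)[OF q(1)] p(2) Suc.prems(4) by auto
  next
    case False
    then show ?thesis using q(2) that by auto
  qed
  ultimately have tlq: "set (tl q) \<inter> (S \<union> set p) = {}" by auto
  then have "p @ tl q \<in> lpaths G (r * l + l) (w 0) (w (Suc r))"
    using lpaths_append[OF p(1) q(1)] by blast
  moreover have "set (p @ tl q) \<inter> S = {}" using tlq p(2) by auto
  ultimately show ?case by (intro bexI[of _ "p @ tl q"]) (simp_all add: add.commute)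
qed

end

section \<open>Fat pairs of paths\<close>

context even_cycle_free_graph
begin

text \<open>Chooses the number \<open>r\<close> of links and the position \<open>s\<close> for a
  closed chain of length \<open>2 * k\<close>. If \<open>l\<close> does not divide \<open>k\<close>,
  an even \<open>r\<close> works with \<open>s = k mod l\<close>; otherwise \<open>r\<close> is odd
  and the part through \<open>x\<close> has length \<open>l\<close> for any
  \<open>s\<close>.\<close>

lemma split_even_length:
  "\<exists>s r. 0 < s \<and> s < l \<and> 0 < r \<and> r * l + s + (if even r then s else l - s) = 2 * k"
proof (cases "l dvd k")
  case False
  then have s: "k mod l \<noteq> 0" by (simp add: mod_eq_0_iff_dvd)
  have "k div l \<noteq> 0" using k_gt_l l_ge_2 by (simp add: div_eq_0_iff)
  moreover have "2 * (k div l) * l + 2 * (k mod l) = 2 * k"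
    by (metis add_mult_distrib2 div_mult_mod_eq mult.assoc)
  ultimately show ?thesis using s l_ge_2
    by (intro exI[of _ "k mod l"] exI[of _ "2 * (k div l)"]) auto
next
  case True
  then obtain j where j: "k = l * j" by blast
  have "j \<ge> 2" using j k_gt_l by (cases j; cases "j - 1") auto
  then have "(2 * j - 1) * l + l = 2 * k" using j by (simp add: diff_mult_distrib)
  then show ?thesis using l_ge_2 \<open>j \<ge> 2\<close> by (intro exI[of _ 1] exI[of _ "2 * j - 1"]) auto
qed

text \<open>Too many such pairs yield distinct paths \<open>P\<^sub>0, \<dots>, P\<^sub>r\<close> from \<open>x\<close> to \<open>y\<close> in which the points at
  distance \<open>s\<close> (on even members) and \<open>l - s\<close> (on odd members) from \<open>x\<close> are consecutively linked by
  many paths of length \<open>l\<close>. A chain of such links, closed up through \<open>x\<close>, has length \<open>2 * k\<close>.\<close>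

lemma card_fat_pairs:
  assumes s: "0 < s" "s < l" and r: "0 < r"
    and len: "r * l + s + (if even r then s else l - s) = 2 * k"
  shows "card {(P, Q). P \<in> lpaths G l x y \<and> Q \<in> lpaths G l x y \<and> P \<noteq> Q
           \<and> 2 * k \<le> num_paths (P ! s) (Q ! (l - s))} \<le> 2 * k * (2 * num_paths x y)"
    (is "card ?E \<le> _")
proof (rule ccontr)
  assume big: "\<not> ?thesis"
  let ?P = "lpaths G l x y"
  have "?E \<subseteq> ?P \<times> ?P" by auto
  then have finE: "finite ?E" by (rule finite_subset) (simp add: finite_lpaths)
  have "card (Domain ?E) \<le> num_paths x y" "card (Range ?E) \<le> num_paths x y"
    using finite_lpaths by (auto intro!: card_mono)
  then have "2 * k * (card (Domain ?E) + card (Range ?E)) \<le> 2 * k * (2 * num_paths x y)"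
    by (intro mult_le_mono2) simp
  then have "2 * k * (card (Domain ?E) + card (Range ?E)) < card ?E" using big by linarith
  from min_degree_subrelation[OF finE this] obtain F where F: "F \<subseteq> ?E" "F \<noteq> {}"
    and degD: "\<forall>a\<in>Domain F. 2 * k < card (F `` {a})"
    and degR: "\<forall>b\<in>Range F. 2 * k < card (F\<inverse> `` {b})"
    by (elim exE conjE)
  have FD: "P \<in> ?P \<and> Q \<in> ?P \<and> 2 * k \<le> num_paths (P ! s) (Q ! (l - s))" if "(P, Q) \<in> F" for P Q
    using that F(1) by auto
  obtain P0 where P0: "P0 \<in> Domain F" using F(2) by auto
  have "r * 1 \<le> r * l" using l_ge_2 by (intro mult_le_mono2) simp
  then have "r + card {} \<le> 2 * k" using len unfolding card.empty by linarith
  then obtain zs where zs: "length zs = Suc r" "zs ! 0 = P0" "zigzag F zs"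
    using zigzag_exists[OF degD degR P0, of "{}" r] by auto
  have zsP: "zs ! i \<in> ?P" if "i \<le> r" for i
  proof -
    have "zs ! i \<in> Domain F \<or> zs ! i \<in> Range F"
      using zigzag_nth_mem[OF zs(3), of i] zs(1,2) P0 that by (simp split: if_splits)
    then show ?thesis using FD by blast
  qed
  define c where "c i = (if even i then s else l - s)" for i :: nat
  have c: "0 < c i" "c i < l" for i using s unfolding c_def by auto
  define w where "w i = zs ! i ! c i" for i
  \<comment> \<open>Distinct members of the zigzag are internally disjoint, so an internal vertex of
    one lies on no other.\<close>
  have apart: "i = j" if "i \<le> r" "j \<le> r" "a \<le> l" "0 < b" "b < l" "zs ! i ! a = zs ! j ! b"
    for i j a b
  proof -
    have "zs ! i = zs ! j"
      using lpaths_internally_disjoint[OF zsP zsP, of i j a b] that by fastforce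
    then show ?thesis using zs(1,3) that unfolding zigzag_def by (simp add: nth_eq_iff_index_eq)
  qed
  have link: "2 * k \<le> num_paths (w i) (w (Suc i))" if "i < r" for i
  proof (cases "even i")
    case True
    then have "(zs ! i, zs ! Suc i) \<in> F" using zs that unfolding zigzag_def by simp
    then show ?thesis using FD True unfolding w_def c_def by simp
  next
    case False
    then have "(zs ! Suc i, zs ! i) \<in> F" using zs that unfolding zigzag_def by simp
    then show ?thesis using FD False num_paths_commute unfolding w_def c_def by simp
  qed
  have inj_w: "inj_on w {..r}"
    using apart c unfolding w_def by (intro inj_onI) (metis atMost_iff less_imp_le)

  \<comment> \<open>\<open>A\<close> leads from \<open>w 0\<close> back to \<open>x\<close>, and
    \<open>B\<close> from \<open>x\<close> on to \<open>w r\<close>; together they close the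
    chain.\<close>
  define A where "A = rev (take (Suc s) (zs ! 0))"
  define B where "B = take (Suc (c r)) (zs ! r)"
  have P0: "zs ! 0 \<in> ?P" and Pr: "zs ! r \<in> ?P" using zsP by auto
  have A: "A \<in> lpaths G s (w 0) x"
    using lpaths_rev[OF lpaths_take[OF P0, of s]] s unfolding A_def w_def c_def by simp
  have B: "B \<in> lpaths G (c r) x (w r)"
    using lpaths_take[OF Pr, of "c r"] c[of r] unfolding B_def w_def by simp
  have setA: "set A = (!) (zs ! 0) ` {..s}"
    using set_take_lpaths[OF P0, of s] s unfolding A_def by simp
  have "tl B = drop 1 B" by (simp add: drop_Suc)
  then have "set (tl B) = (!) B ` {1..c r}" using set_drop_lpaths[OF B, of 1] by simp
  also have "\<dots> = (!) (zs ! r) ` {1..c r}" unfolding B_def by (intro image_cong) auto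
  finally have setB: "set (tl B) = (!) (zs ! r) ` {1..c r}" .
  have "set A \<inter> set (tl B) = {}"
  proof (rule ccontr)
    assume "set A \<inter> set (tl B) \<noteq> {}"
    then obtain a b where "a \<le> s" "1 \<le> b" "b \<le> c r" "zs ! 0 ! a = zs ! r ! b"
      unfolding setA setB by auto
    then show False using apart[of 0 r a b] s c[of r] r by auto
  qed
  then have AB: "A @ tl B \<in> lpaths G (s + c r) (w 0) (w r)" by (rule lpaths_append[OF A B])
  define S where "S = set (A @ tl B) - {w 0, w r}"
  have "w 0 \<noteq> w r" using inj_w r by (auto simp: inj_on_def)
  \<comment> \<open>Only the interior of the closing path must be avoided. Its
    \<open>s + c r - 1\<close> vertices make the threshold of \<open>chain_avoiding\<close> exactly
    \<open>2 * k\<close>.\<close>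
  have "card S + 2 = card (set (A @ tl B))"
  proof -
    have "w 0 \<in> set (A @ tl B)" "w r \<in> set (A @ tl B)"
      using lpathsD(3-5)[OF AB] by (metis le_add1 le_imp_less_Suc nth_mem order_refl zero_less_Suc)+
    then have "card {w 0, w r} \<le> card (set (A @ tl B))" by (intro card_mono) auto
    then show ?thesis
      unfolding S_def using \<open>w 0 \<noteq> w r\<close> \<open>w 0 \<in> _\<close> \<open>w r \<in> _\<close>
      by (subst card_Diff_subset) auto
  qed
  also have "\<dots> = s + c r + 1"
    using lpathsD(2,3)[OF AB] distinct_card by fastforce
  finally have "card S + r * l + 1 = 2 * k" using len unfolding c_def by simp
  moreover have "w ` {..r} \<inter> S = {}"
  proof (rule ccontr)
    assume "w ` {..r} \<inter> S \<noteq> {}"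
    then obtain i where i: "i \<le> r" "w i \<in> S" by auto
    then consider a where "a \<le> s" "w i = zs ! 0 ! a" | b where "b \<le> c r" "w i = zs ! r ! b"
      unfolding S_def using setA setB by auto
    then show False
    proof cases
      case 1
      then have "i = 0"
        using apart[of 0 i a "c i"] i(1) c[of i] s unfolding w_def by auto
      then show False using i(2) unfolding S_def by simp
    next
      case 2
      then have "i = r"
        using apart[of r i b "c i"] i(1) c[of i] c[of r] unfolding w_def by auto
      then show False using i(2) unfolding S_def by simp
    qed
  qed
  moreover have "finite S" unfolding S_def by simp
  ultimately obtain p where p: "p \<in> lpaths G (r * l) (w 0) (w r)" "set p \<inter> S = {}"
    using chain_avoiding[of r "2 * k" w S] link inj_w by auto
  have "set p \<inter> set (A @ tl B) \<subseteq> {w 0, w r}" using p(2) unfolding S_def by blast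
  moreover have "r * l + (s + c r) = 2 * k" using len unfolding c_def by simp
  ultimately show False
    using two_paths_cycle[OF p(1) AB \<open>w 0 \<noteq> w r\<close>] no_even_cycle k_gt_l l_ge_2 by simp
qed

end

section \<open>Rotating cycles of length \<open>2 * l\<close>\<close>

lemma set_tl_lpaths:
  assumes "p \<in> lpaths G a u v"
  shows "set (tl p) = set p - {u}"
  using lpathsD(2-4)[OF assms] by (cases p) auto

context girth_graph
begin

lemma sum_num_paths_le: "(\<Sum>y<n. num_paths x y) \<le> card (paths_from x)"
proof -
  have "(\<Sum>y<n. num_paths x y) = card (\<Union>y<n. lpaths G l x y)"
    by (rule card_UN_disjoint[symmetric]) (auto simp: finite_lpaths dest: lpathsD(5))
  also have "\<dots> \<le> card (paths_from x)"
    by (intro card_mono finite_paths_from) (auto simp: paths_from_def)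
  finally show ?thesis .
qed

text \<open>Two paths of length \<open>l\<close> with the same ends form a cycle of length \<open>2 * l\<close>. Cutting it at
  another antipodal pair, \<open>P ! s\<close> and \<open>Q ! (l - s)\<close>, again gives two paths of length \<open>l\<close>.\<close>

definition rotate_pair :: "nat \<Rightarrow> nat list \<times> nat list \<Rightarrow> nat list \<times> nat list" where
  "rotate_pair s = (\<lambda>(P, Q). (rev (take (Suc s) P) @ tl (take (Suc (l - s)) Q),
     drop s P @ tl (rev (drop (l - s) Q))))"

text \<open>The first new path runs through \<open>x\<close> and the second through
  \<open>y\<close>, each of length \<open>s + (l - s)\<close>. They are simple because
  \<open>P\<close> and \<open>Q\<close> share only their ends.\<close>

lemma rotate_pair_mem:
  assumes P: "P \<in> lpaths G l x y" and Q: "Q \<in> lpaths G l x y" and "P \<noteq> Q"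
    and s: "0 < s" "s < l"
  shows "rotate_pair s (P, Q) \<in> lpaths G l (P ! s) (Q ! (l - s)) \<times> lpaths G l (P ! s) (Q ! (l - s))"
proof -
  have meet: "i = 0 \<and> j = 0 \<or> i = l \<and> j = l" if "i \<le> l" "j \<le> l" "P ! i = Q ! j" for i j
    using lpaths_internally_disjoint[OF P Q \<open>P \<noteq> Q\<close>] that by blast
  have 1: "rev (take (Suc s) P) \<in> lpaths G s (P ! s) x"
    using lpaths_rev[OF lpaths_take[OF P, of s]] s by simp
  have 2: "take (Suc (l - s)) Q \<in> lpaths G (l - s) x (Q ! (l - s))"
    using lpaths_take[OF Q, of "l - s"] by simp
  have 3: "drop s P \<in> lpaths G (l - s) (P ! s) y"
    using lpaths_drop[OF P, of s] s by simp
  have 4: "rev (drop (l - s) Q) \<in> lpaths G s y (Q ! (l - s))"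
    using lpaths_rev[OF lpaths_drop[OF Q, of "l - s"]] s by simp
  have "set (rev (take (Suc s) P)) \<inter> set (tl (take (Suc (l - s)) Q)) = {}"
  proof (rule ccontr)
    assume "\<not> ?thesis"
    then obtain i j where "i \<le> s" "j \<le> l - s" "P ! i = Q ! j" "Q ! j \<noteq> x"
      unfolding set_tl_lpaths[OF 2] using set_take_lpaths[OF P, of s] set_take_lpaths[OF Q, of "l - s"] s
      by auto
    then show False using meet[of i j] s lpathsD(4)[OF Q] by force
  qed
  from lpaths_append[OF 1 2 this]
  have "rev (take (Suc s) P) @ tl (take (Suc (l - s)) Q) \<in> lpaths G l (P ! s) (Q ! (l - s))"
    using s by simp
  moreover have "set (drop s P) \<inter> set (tl (rev (drop (l - s) Q))) = {}"
  proof (rule ccontr)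
    assume "\<not> ?thesis"
    then obtain w where w: "w \<in> set (drop s P)" "w \<in> set (drop (l - s) Q)" "w \<noteq> y"
      unfolding set_tl_lpaths[OF 4] by auto
    obtain i where i: "s \<le> i" "i \<le> l" "w = P ! i"
      using w(1) unfolding set_drop_lpaths[OF P] by auto
    obtain j where j: "l - s \<le> j" "j \<le> l" "w = Q ! j"
      using w(2) unfolding set_drop_lpaths[OF Q] by auto
    from w(3) i j show False using meet[of i j] s lpathsD(5)[OF Q] by force
  qed
  from lpaths_append[OF 3 4 this]
  have "drop s P @ tl (rev (drop (l - s) Q)) \<in> lpaths G l (P ! s) (Q ! (l - s))"
    using s by simp
  ultimately show ?thesis unfolding rotate_pair_def by simp
qed

text \<open>The rotated pair contains all of \<open>P\<close>, and all of \<open>Q\<close> except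
  the ends, which are known from \<open>P\<close>.\<close>

lemma rotate_pair_inj:
  assumes P: "P \<in> lpaths G l x y" and Q: "Q \<in> lpaths G l x y"
    and P': "P' \<in> lpaths G l x' y'" and Q': "Q' \<in> lpaths G l x' y'"
    and s: "0 < s" "s < l" and eq: "rotate_pair s (P, Q) = rotate_pair s (P', Q')"
  shows "P = P'" "Q = Q'"
proof -
  note PQ = lpathsD(3-5)[OF P] lpathsD(3-5)[OF Q] lpathsD(3-5)[OF P'] lpathsD(3-5)[OF Q']
  have "take (Suc s) P = take (Suc s) P'"
    and tQ: "tl (take (Suc (l - s)) Q) = tl (take (Suc (l - s)) Q')"
    and dP: "drop s P = drop s P'"
    and dQ: "tl (rev (drop (l - s) Q)) = tl (rev (drop (l - s) Q'))"
    using eq PQ unfolding rotate_pair_def by auto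
  moreover from this(1) have "take s P = take s P'"
    by (metis le_SucI min.absorb1 order_refl take_take)
  ultimately show "P = P'" by (metis append_take_drop_id)
  then have xy: "x = x'" "y = y'" using PQ by auto
  have hd1: "R = R ! 0 # tl R" if "length R > 0" for R :: "nat list" using that by (cases R) auto
  have "take (Suc (l - s)) Q = take (Suc (l - s)) Q'"
    using hd1[of "take (Suc (l - s)) Q"] hd1[of "take (Suc (l - s)) Q'"] tQ PQ xy by simp
  then have "take (l - s) Q = take (l - s) Q'"
    by (metis le_SucI min.absorb1 order_refl take_take)
  moreover have "rev (drop (l - s) Q) ! 0 = y" "rev (drop (l - s) Q') ! 0 = y"
    using PQ xy s by (auto simp: rev_nth)
  then have "rev (drop (l - s) Q) = rev (drop (l - s) Q')"
    using hd1[of "rev (drop (l - s) Q)"] hd1[of "rev (drop (l - s) Q')"] dQ PQ s by simp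
  ultimately show "Q = Q'" by (metis append_take_drop_id rev_rev_ident)
qed

text \<open>Rotation is injective and lands in pairs of paths between ends joined by fewer than
  \<open>T\<close> paths; each of the \<open>n\<^sup>2\<close> possible ends receives at most
  \<open>T\<^sup>2\<close> such pairs.\<close>

lemma sum_thin_pairs:
  assumes s: "0 < s" "s < l"
  shows "(\<Sum>(x, y)\<in>{..<n} \<times> {..<n}. card {(P, Q). P \<in> lpaths G l x y \<and> Q \<in> lpaths G l x y
      \<and> P \<noteq> Q \<and> num_paths (P ! s) (Q ! (l - s)) < T}) \<le> n\<^sup>2 * T\<^sup>2"
proof -
  let ?I = "{..<n} \<times> {..<n}"
  define N where "N = (\<lambda>(x, y). {(P, Q). P \<in> lpaths G l x y \<and> Q \<in> lpaths G l x y
      \<and> P \<noteq> Q \<and> num_paths (P ! s) (Q ! (l - s)) < T})"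
  define M where "M = (\<lambda>(u, v). if num_paths u v < T then lpaths G l u v \<times> lpaths G l u v else {})"
  have "finite (N z)" for z
  proof -
    obtain x y where z: "z = (x, y)" by (cases z)
    have "N z \<subseteq> lpaths G l x y \<times> lpaths G l x y" unfolding N_def z by auto
    then show ?thesis by (rule finite_subset) (simp add: finite_lpaths)
  qed
  moreover have "N z \<inter> N z' = {}" if "z \<noteq> z'" for z z'
    using that unfolding N_def lpaths_def by auto
  ultimately have "(\<Sum>z\<in>?I. card (N z)) = card (\<Union>z\<in>?I. N z)"
    by (intro card_UN_disjoint[symmetric]) auto
  also have "\<dots> \<le> card (\<Union>z\<in>?I. M z)"
  proof (rule card_inj_on_le)
    show "inj_on (rotate_pair s) (\<Union>z\<in>?I. N z)"
    proof (rule inj_onI)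
      fix a b assume ab: "a \<in> (\<Union>z\<in>?I. N z)" "b \<in> (\<Union>z\<in>?I. N z)"
        and eq: "rotate_pair s a = rotate_pair s b"
      obtain P Q P' Q' where PQ: "a = (P, Q)" "b = (P', Q')" by (cases a, cases b)
      obtain x y x' y' where "P \<in> lpaths G l x y" "Q \<in> lpaths G l x y"
          "P' \<in> lpaths G l x' y'" "Q' \<in> lpaths G l x' y'"
        using ab PQ unfolding N_def by auto
      from rotate_pair_inj[OF this s] eq PQ show "a = b" by simp
    qed
    show "rotate_pair s ` (\<Union>z\<in>?I. N z) \<subseteq> (\<Union>z\<in>?I. M z)"
    proof
      fix c assume "c \<in> rotate_pair s ` (\<Union>z\<in>?I. N z)"
      then obtain x y P Q where PQ: "P \<in> lpaths G l x y" "Q \<in> lpaths G l x y" "P \<noteq> Q"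
          "num_paths (P ! s) (Q ! (l - s)) < T" "c = rotate_pair s (P, Q)"
        unfolding N_def by auto
      have "c \<in> M (P ! s, Q ! (l - s))"
        using rotate_pair_mem[OF PQ(1-3) s] PQ(4,5) unfolding M_def by simp
      moreover have "P ! s < n" "Q ! (l - s) < n"
        using lpaths_less[OF PQ(1)] lpaths_less[OF PQ(2)] s by simp_all
      ultimately show "c \<in> (\<Union>z\<in>?I. M z)" by blast
    qed
    show "finite (\<Union>z\<in>?I. M z)" unfolding M_def by (auto simp: finite_lpaths)
  qed
  also have "\<dots> \<le> (\<Sum>z\<in>?I. card (M z))" by (rule card_UN_le) simp
  also have "\<dots> \<le> (\<Sum>z\<in>?I. T\<^sup>2)"
    unfolding M_def
    by (intro sum_mono) (auto simp: card_cartesian_product power2_eq_square intro!: mult_le_mono)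
  also have "\<dots> = n\<^sup>2 * T\<^sup>2" by (simp add: power2_eq_square)
  finally show ?thesis unfolding N_def by (simp add: case_prod_unfold)
qed

end

context even_cycle_free_graph
begin

text \<open>The square counts pairs of paths. Equal and fat pairs are linear in
  \<open>num_paths x y\<close> and are summed by \<open>card_paths_from\<close>; the thin ones are
  counted by rotation.\<close>

lemma sum_num_paths_square:
  "(\<Sum>(x, y)\<in>{..<n} \<times> {..<n}. (num_paths x y)\<^sup>2) \<le> (2 * (1 + 4 * k) * (2 * k + 1) + 4 * k\<^sup>2) * n\<^sup>2"
proof -
  let ?I = "{..<n} \<times> {..<n}"
  obtain s r where s: "0 < s" "s < l" and r: "0 < r"
    and len: "r * l + s + (if even r then s else l - s) = 2 * k"
    using split_even_length by blast
  let ?fat = "\<lambda>x y. {(P, Q). P \<in> lpaths G l x y \<and> Q \<in> lpaths G l x y \<and> P \<noteq> Q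
           \<and> 2 * k \<le> num_paths (P ! s) (Q ! (l - s))}"
  let ?thin = "\<lambda>x y. {(P, Q). P \<in> lpaths G l x y \<and> Q \<in> lpaths G l x y \<and> P \<noteq> Q
           \<and> num_paths (P ! s) (Q ! (l - s)) < 2 * k}"
  have "(num_paths x y)\<^sup>2 \<le> (1 + 4 * k) * num_paths x y + card (?thin x y)" for x y
  proof -
    let ?L = "lpaths G l x y" and ?diag = "(\<lambda>P. (P, P)) ` lpaths G l x y"
    have "?L \<times> ?L = (?diag \<union> ?fat x y) \<union> ?thin x y" by auto
    then have "card (?L \<times> ?L) \<le> card ?diag + card (?fat x y) + card (?thin x y)"
      by (metis (no_types, lifting) add_le_mono1 card_Un_le le_trans)
    moreover have "card ?diag \<le> num_paths x y" by (rule card_image_le[OF finite_lpaths])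
    moreover have "card (?fat x y) \<le> 2 * k * (2 * num_paths x y)" by (rule card_fat_pairs[OF s r len])
    moreover have "card (?L \<times> ?L) = (num_paths x y)\<^sup>2"
      by (simp add: card_cartesian_product power2_eq_square)
    ultimately show ?thesis by (simp add: algebra_simps)
  qed
  then have "(\<Sum>(x, y)\<in>?I. (num_paths x y)\<^sup>2)
      \<le> (\<Sum>(x, y)\<in>?I. (1 + 4 * k) * num_paths x y + card (?thin x y))"
    by (intro sum_mono) auto
  also have "\<dots> = (1 + 4 * k) * (\<Sum>x<n. \<Sum>y<n. num_paths x y) + (\<Sum>(x, y)\<in>?I. card (?thin x y))"
    by (simp only: case_prod_unfold sum.distrib sum_distrib_left sum.cartesian_product)
  also have "\<dots> \<le> (1 + 4 * k) * ((2 * k + 1) * (2 * n) * n) + n\<^sup>2 * (2 * k)\<^sup>2"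
  proof (intro add_mono mult_le_mono2)
    have "(\<Sum>x<n. \<Sum>y<n. num_paths x y) \<le> (\<Sum>x<n. (2 * k + 1) * (2 * n))"
      by (intro sum_mono order_trans[OF sum_num_paths_le card_paths_from])
    then show "(\<Sum>x<n. \<Sum>y<n. num_paths x y) \<le> (2 * k + 1) * (2 * n) * n" by (simp add: mult.commute)
  qed (rule sum_thin_pairs[OF s])
  also have "\<dots> = (2 * (1 + 4 * k) * (2 * k + 1) + 4 * k\<^sup>2) * n\<^sup>2"
    by (simp add: power2_eq_square algebra_simps)
  finally show ?thesis .
qed

end

subsection \<open>The number of cycles of length ml\<close>

text \<open>Indexed from the first power: \<open>mat_pow n a j\<close> is the \<open>(j + 1)\<close>-st power of the matrix \<open>a\<close>.\<close>

primrec mat_pow :: "nat \<Rightarrow> (nat \<Rightarrow> nat \<Rightarrow> real) \<Rightarrow> nat \<Rightarrow> nat \<Rightarrow> nat \<Rightarrow> real" where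
  "mat_pow n a 0 = a"
| "mat_pow n a (Suc j) = (\<lambda>u v. \<Sum>w<n. mat_pow n a j u w * a w v)"

text \<open>Submultiplicativity of the Frobenius norm, by Cauchy-Schwarz in each entry.\<close>

lemma frobenius_mat_pow:
  "(\<Sum>u<n. \<Sum>v<n. (mat_pow n a j u v)\<^sup>2) \<le> (\<Sum>u<n. \<Sum>v<n. (a u v)\<^sup>2) ^ Suc j"
proof (induction j)
  case 0
  then show ?case by simp
next
  case (Suc j)
  let ?b = "mat_pow n a j"
  let ?S = "\<Sum>u<n. \<Sum>v<n. (a u v)\<^sup>2"
  have "(\<Sum>u<n. \<Sum>v<n. (mat_pow n a (Suc j) u v)\<^sup>2)
      \<le> (\<Sum>u<n. \<Sum>v<n. (\<Sum>w<n. (?b u w)\<^sup>2) * (\<Sum>w<n. (a w v)\<^sup>2))"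
    by (intro sum_mono) (simp add: Cauchy_Schwarz_ineq_sum)
  also have "\<dots> = (\<Sum>u<n. \<Sum>w<n. (?b u w)\<^sup>2) * (\<Sum>v<n. \<Sum>w<n. (a w v)\<^sup>2)"
    by (simp add: sum_product)
  also have "(\<Sum>v<n. \<Sum>w<n. (a w v)\<^sup>2) = ?S" by (rule sum.swap)
  also have "(\<Sum>u<n. \<Sum>w<n. (?b u w)\<^sup>2) * ?S \<le> ?S ^ Suc j * ?S"
    by (intro mult_right_mono Suc.IH sum_nonneg) simp
  finally show ?case by (simp add: mult.commute)
qed

text \<open>The trace of a product is the inner product of one factor with the transpose of the
  other, so Cauchy-Schwarz applies once more.\<close>

lemma trace_mat_pow:
  "(\<Sum>u<n. mat_pow n a (Suc j) u u)\<^sup>2 \<le> (\<Sum>u<n. \<Sum>v<n. (a u v)\<^sup>2) ^ Suc (Suc j)"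
proof -
  let ?b = "mat_pow n a j" and ?I = "{..<n} \<times> {..<n}"
  let ?S = "\<Sum>u<n. \<Sum>v<n. (a u v)\<^sup>2"
  have "(\<Sum>u<n. mat_pow n a (Suc j) u u)\<^sup>2 = (\<Sum>z\<in>?I. ?b (fst z) (snd z) * a (snd z) (fst z))\<^sup>2"
    by (simp add: sum.cartesian_product case_prod_unfold)
  also have "\<dots> \<le> (\<Sum>z\<in>?I. (?b (fst z) (snd z))\<^sup>2) * (\<Sum>z\<in>?I. (a (snd z) (fst z))\<^sup>2)"
    by (rule Cauchy_Schwarz_ineq_sum)
  also have "\<dots> = (\<Sum>u<n. \<Sum>w<n. (?b u w)\<^sup>2) * (\<Sum>u<n. \<Sum>w<n. (a w u)\<^sup>2)"
    by (simp add: sum.cartesian_product case_prod_unfold)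
  also have "(\<Sum>u<n. \<Sum>w<n. (a w u)\<^sup>2) = ?S" by (rule sum.swap)
  also have "(\<Sum>u<n. \<Sum>w<n. (?b u w)\<^sup>2) * ?S \<le> ?S ^ Suc j * ?S"
    by (intro mult_right_mono frobenius_mat_pow sum_nonneg) simp
  finally show ?thesis by (simp add: mult.commute)
qed

section \<open>Closed walks made of blocks\<close>

context girth_graph
begin

text \<open>Walks made of \<open>j\<close> consecutive paths of length \<open>l\<close>; distinct blocks may share vertices.\<close>

definition block_walks :: "nat \<Rightarrow> nat \<Rightarrow> nat \<Rightarrow> nat list set" where
  "block_walks j u v = {xs. length xs = Suc (j * l) \<and> xs ! 0 = u \<and> xs ! (j * l) = v \<and>
     (\<forall>i<j. take (Suc l) (drop (i * l) xs) \<in> lpaths G l (xs ! (i * l)) (xs ! (Suc i * l)))}"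

text \<open>Cutting off the last block, with the cut vertex kept in both pieces, is injective;
  summing over that vertex is matrix multiplication.\<close>

lemma block_walks_bound:
  "finite (block_walks (Suc j) u v) \<and>
   real (card (block_walks (Suc j) u v)) \<le> mat_pow n (\<lambda>u v. real (num_paths u v)) j u v"
proof (induction j arbitrary: v)
  case 0
  have sub: "block_walks (Suc 0) u v \<subseteq> lpaths G l u v" by (auto simp: block_walks_def)
  then show ?case
    using finite_subset[OF sub finite_lpaths] card_mono[OF finite_lpaths sub] by simp
next
  case (Suc j)
  let ?B = "block_walks (Suc (Suc j)) u v" and ?L = "Suc j * l"
  let ?C = "\<Union>w<n. block_walks (Suc j) u w \<times> lpaths G l w v"
  let ?f = "\<lambda>xs. (take (Suc ?L) xs, drop ?L xs)"
  have inj: "inj_on ?f ?B"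
  proof (rule inj_onI)
    fix xs ys :: "nat list" assume "?f xs = ?f ys"
    then have "take ?L xs = take ?L ys" "drop ?L xs = drop ?L ys"
      by (auto dest: arg_cong[of _ _ "take ?L"])
    then show "xs = ys" by (metis append_take_drop_id)
  qed
  have sub: "?f ` ?B \<subseteq> ?C"
  proof
    fix c assume "c \<in> ?f ` ?B"
    then obtain xs where xs: "xs \<in> ?B" "c = ?f xs" by blast
    have len: "length xs = Suc (?L + l)" and ends: "xs ! 0 = u" "xs ! (?L + l) = v"
      and blk: "\<And>i. i < Suc (Suc j) \<Longrightarrow>
        take (Suc l) (drop (i * l) xs) \<in> lpaths G l (xs ! (i * l)) (xs ! (Suc i * l))"
      using xs(1) by (auto simp: block_walks_def add.commute)
    have d: "drop ?L xs \<in> lpaths G l (xs ! ?L) v"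
      using blk[of "Suc j"] len ends by (simp add: add.commute)
    have "take (Suc ?L) xs \<in> block_walks (Suc j) u (xs ! ?L)"
      unfolding block_walks_def
    proof (intro CollectI conjI allI impI)
      fix i assume i: "i < Suc j"
      then have il: "Suc i * l \<le> ?L" by (intro mult_le_mono1) simp
      then have "Suc l \<le> Suc ?L - i * l" unfolding mult_Suc by linarith
      then have "take (Suc l) (drop (i * l) (take (Suc ?L) xs)) = take (Suc l) (drop (i * l) xs)"
        by (simp only: drop_take take_take min_absorb1)
      moreover have "take (Suc ?L) xs ! (i * l) = xs ! (i * l)"
        "take (Suc ?L) xs ! (Suc i * l) = xs ! (Suc i * l)"
        using il unfolding mult_Suc by (intro nth_take; linarith)+
      ultimately show "take (Suc l) (drop (i * l) (take (Suc ?L) xs))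
          \<in> lpaths G l (take (Suc ?L) xs ! (i * l)) (take (Suc ?L) xs ! (Suc i * l))"
        using blk[of i] i by simp
    qed (use len ends in auto)
    moreover have "xs ! ?L < n" using lpaths_less[OF d, of 0] l_ge_2 lpathsD(4)[OF d] by simp
    ultimately show "c \<in> ?C" using d xs(2) by auto
  qed
  have finC: "finite ?C" using Suc.IH finite_lpaths by auto
  note finB = inj_on_finite[OF inj sub finC] and card_inj_on_le[OF inj sub finC]
  moreover have "card ?C \<le> (\<Sum>w<n. card (block_walks (Suc j) u w) * num_paths w v)"
    using card_UN_le[of "{..<n}" "\<lambda>w. block_walks (Suc j) u w \<times> lpaths G l w v"]
    by (simp add: card_cartesian_product)
  ultimately have "real (card ?B) \<le> real (\<Sum>w<n. card (block_walks (Suc j) u w) * num_paths w v)"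
    by linarith
  also have "\<dots> \<le> mat_pow n (\<lambda>u v. real (num_paths u v)) (Suc j) u v"
    using Suc.IH by (auto intro!: sum_mono mult_right_mono)
  finally show ?case using finB by blast
qed

text \<open>Going once round a cycle, with \<open>f 0\<close> repeated at the end, gives a closed
  walk from which the cycle can be read off. Each block is a path, since \<open>m \<ge> 2\<close>
  makes it shorter than the cycle.\<close>

lemma num_cycles_le:
  assumes "m \<ge> 2"
  shows "num_cycles G (m * l) \<le> (\<Sum>u<n. card (block_walks m u u))"
proof -
  let ?K = "m * l" and ?U = "\<Union>u<n. block_walks m u u"
  have "l < ?K" using assms l_ge_2 by simp
  have "{cycle_edges ?K f | f. cycle_in G ?K f} \<subseteq> (\<lambda>xs. cycle_edges ?K ((!) xs)) ` ?U"
  proof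
    fix c assume "c \<in> {cycle_edges ?K f | f. cycle_in G ?K f}"
    then obtain f where f: "c = cycle_edges ?K f" "cycle_in G ?K f" by blast
    define xs where "xs = map (\<lambda>i. f (i mod ?K)) [0..<Suc ?K]"
    have nth: "xs ! i = f (i mod ?K)" if "i \<le> ?K" for i
      using that unfolding xs_def by (simp del: upt_Suc)
    have len: "length xs = Suc ?K" unfolding xs_def by simp
    have inj: "inj_on f {..<?K}" and edge: "\<And>i. i < ?K \<Longrightarrow> {f i, f (Suc i mod ?K)} \<in> G"
      using f(2) unfolding cycle_in_def by auto
    have "xs \<in> block_walks m (f 0) (f 0)"
      unfolding block_walks_def
    proof (intro CollectI conjI allI impI)
      fix i assume i: "i < m"
      let ?ys = "take (Suc l) (drop (i * l) xs)"
      have il: "Suc i * l \<le> ?K" using i by (intro mult_le_mono1) simp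
      have ylen: "length ?ys = Suc l" using len il by simp
      have ynth: "?ys ! j = f ((i * l + j) mod ?K)" if "j \<le> l" for j
        using that nth[of "i * l + j"] il len by simp
      have "distinct ?ys"
        unfolding distinct_conv_nth
      proof (intro allI impI)
        fix a b assume ab: "a < length ?ys" "b < length ?ys" "a \<noteq> b"
        have "(i * l + a) mod ?K \<noteq> (i * l + b) mod ?K"
        proof
          assume "(i * l + a) mod ?K = (i * l + b) mod ?K"
          then have "[i * l + a = i * l + b] (mod ?K)" by (simp add: cong_def)
          then have "[a = b] (mod ?K)" by (simp add: cong_add_lcancel_nat)
          then show False using ab ylen \<open>l < ?K\<close> by (simp add: cong_def)
        qed
        then show "?ys ! a \<noteq> ?ys ! b"
          using ab ylen ynth inj \<open>l < ?K\<close> by (auto simp: inj_on_def)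
      qed
      moreover have "{?ys ! j, ?ys ! Suc j} \<in> G" if "Suc j < length ?ys" for j
      proof -
        have "Suc ((i * l + j) mod ?K) mod ?K = (i * l + Suc j) mod ?K" by (simp add: mod_Suc_eq)
        then show ?thesis
          using edge[of "(i * l + j) mod ?K"] that ylen ynth[of j] ynth[of "Suc j"] \<open>l < ?K\<close> by simp
      qed
      ultimately have "path G ?ys" unfolding path_def by (simp add: successively_conv_nth)
      then show "?ys \<in> lpaths G l (xs ! (i * l)) (xs ! (Suc i * l))"
        using ylen len il unfolding lpaths_def by (simp add: add.commute)
    qed (use len nth in auto)
    moreover have "f 0 < n" using edge_less edge[of 0] \<open>l < ?K\<close> by force
    moreover have "{xs ! i, xs ! (Suc i mod ?K)} = {f i, f (Suc i mod ?K)}" if "i < ?K" for i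
    proof -
      have "Suc i mod ?K < ?K" using that by (intro mod_less_divisor) linarith
      then show ?thesis using nth[of i] nth[of "Suc i mod ?K"] that by simp
    qed
    then have "cycle_edges ?K ((!) xs) = c"
      unfolding f(1) cycle_edges_def by (intro Collect_cong) metis
    ultimately show "c \<in> (\<lambda>xs. cycle_edges ?K ((!) xs)) ` ?U" by blast
  qed
  moreover have finU: "finite ?U" using block_walks_bound[of "m - 1"] assms by auto
  ultimately have "num_cycles G ?K \<le> card ((\<lambda>xs. cycle_edges ?K ((!) xs)) ` ?U)"
    unfolding num_cycles_def by (intro card_mono) auto
  also have "\<dots> \<le> card ?U" by (rule card_image_le[OF finU])
  also have "\<dots> \<le> (\<Sum>u<n. card (block_walks m u u))" by (rule card_UN_le) simp
  finally show ?thesis .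
qed

end

context even_cycle_free_graph
begin

lemma num_cycles_upper:
  assumes "m \<ge> 2"
  shows "num_cycles G (m * l) \<le> (2 * (1 + 4 * k) * (2 * k + 1) + 4 * k\<^sup>2) ^ m * n ^ m"
proof -
  define C where "C = 2 * (1 + 4 * k) * (2 * k + 1) + 4 * k\<^sup>2"
  obtain j where "m = 2 + j" using assms le_Suc_ex by blast
  then have j: "m = Suc (Suc j)" by simp
  let ?a = "\<lambda>u v. real (num_paths u v)"
  have "real (num_cycles G (m * l)) \<le> real (\<Sum>u<n. card (block_walks m u u))"
    using num_cycles_le[OF assms] by linarith
  also have "\<dots> \<le> (\<Sum>u<n. mat_pow n ?a (Suc j) u u)"
    using block_walks_bound[of "Suc j"] unfolding of_nat_sum j by (intro sum_mono) simp
  finally have "(real (num_cycles G (m * l)))\<^sup>2 \<le> (\<Sum>u<n. mat_pow n ?a (Suc j) u u)\<^sup>2"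
    by (intro power_mono) auto
  also have "\<dots> \<le> (\<Sum>u<n. \<Sum>v<n. (?a u v)\<^sup>2) ^ m" unfolding j by (rule trace_mat_pow)
  also have "(\<Sum>u<n. \<Sum>v<n. (?a u v)\<^sup>2) = real (\<Sum>(u, v)\<in>{..<n} \<times> {..<n}. (num_paths u v)\<^sup>2)"
    by (simp add: sum.cartesian_product case_prod_unfold)
  also have "\<dots> ^ m \<le> real (C * n\<^sup>2) ^ m"
    using sum_num_paths_square unfolding C_def
    by (intro power_mono) (simp_all only: of_nat_mono of_nat_0_le_iff)
  also have "\<dots> = real C ^ m * (real n ^ m)\<^sup>2"
    by (simp add: power_mult_distrib flip: power_mult) (simp add: mult.commute)
  \<comment> \<open>Weakened so that the right side is a square and the root can be taken.\<close>
  also have "\<dots> \<le> (real C ^ m)\<^sup>2 * (real n ^ m)\<^sup>2"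
  proof (rule mult_right_mono)
    have "1 \<le> real C ^ m" unfolding C_def by (intro one_le_power) simp
    then show "real C ^ m \<le> (real C ^ m)\<^sup>2" by (simp add: power2_eq_square mult_le_cancel_left1)
  qed simp
  finally have "(real (num_cycles G (m * l)))\<^sup>2 \<le> (real C ^ m * real n ^ m)\<^sup>2"
    by (simp add: power_mult_distrib)
  then have "real (num_cycles G (m * l)) \<le> real C ^ m * real n ^ m"
    by (rule power2_le_imp_le) simp
  also have "\<dots> = real (C ^ m * n ^ m)" by simp
  finally show ?thesis unfolding C_def of_nat_le_iff .
qed

end

subsection \<open>The ring of theta graphs\<close>

lemma finite_simple_graph:
  assumes "simple_graph n G"
  shows "finite G"
proof (rule finite_subset)
  show "G \<subseteq> Pow {..<n}" using assms unfolding simple_graph_def by auto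
qed simp

lemma finite_cycles: "finite G \<Longrightarrow> finite {cycle_edges k f | f. cycle_in G k f}"
  by (rule finite_subset[of _ "Pow G"]) (auto simp: cycle_edges_def cycle_in_def)

lemma Union_cycle_edges:
  assumes "K > 0"
  shows "\<Union> (cycle_edges K f) = f ` {..<K}"
proof
  show "\<Union> (cycle_edges K f) \<subseteq> f ` {..<K}"
    using assms by (auto simp: cycle_edges_def)
qed (auto simp: cycle_edges_def)

locale theta_ring =
  fixes l m t :: nat
  assumes l_ge_2: "l \<ge> 2" and m_ge_2: "m \<ge> 2"
begin

text \<open>The hubs are \<open>0, \<dots>, m - 1\<close>; for \<open>a < t\<close>, \<open>seg i a 0, \<dots>, seg i a l\<close> is the \<open>a\<close>-th
  path of length \<open>l\<close> from hub \<open>i\<close> to the cyclically next hub.\<close>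

definition seg :: "nat \<Rightarrow> nat \<Rightarrow> nat \<Rightarrow> nat" where
  "seg i a b = (if b = 0 then i else if b = l then Suc i mod m
     else m + ((i * t + a) * (l - 1) + (b - 1)))"

definition ring_graph :: "nat set set" where
  "ring_graph = {{seg i a b, seg i a (Suc b)} | i a b. i < m \<and> a < t \<and> b < l}"

lemma seg_hub: "i < m \<Longrightarrow> seg i a 0 < m" "seg i a l < m"
  using l_ge_2 m_ge_2 by (auto simp: seg_def)

lemma seg_internal: "0 < b \<Longrightarrow> b < l \<Longrightarrow> m \<le> seg i a b"
  by (simp add: seg_def)

text \<open>Internal vertices are numbered in mixed radix: remainders by \<open>l - 1\<close> and by
  \<open>t\<close> recover \<open>b\<close> and \<open>a\<close>.\<close>

lemma seg_eq:
  assumes "0 < b" "b < l" "0 < b'" "b' < l" "a < t" "a' < t" "seg i a b = seg i' a' b'"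
  shows "i = i'" "a = a'" "b = b'"
proof -
  have eq: "(i * t + a) * (l - 1) + (b - 1) = (i' * t + a') * (l - 1) + (b' - 1)"
    using assms by (simp add: seg_def)
  have lt: "b - 1 < l - 1" "b' - 1 < l - 1" using assms by auto
  have "((i * t + a) * (l - 1) + (b - 1)) mod (l - 1) = b - 1"
    "((i' * t + a') * (l - 1) + (b' - 1)) mod (l - 1) = b' - 1" using lt by simp_all
  then have "b - 1 = b' - 1" using eq by metis
  then show "b = b'" using assms by simp
  then have "(i * t + a) * (l - 1) = (i' * t + a') * (l - 1)" using eq by simp
  then have eq2: "i * t + a = i' * t + a'" using lt l_ge_2 by simp
  have "(i * t + a) mod t = a" "(i' * t + a') mod t = a'" using assms by simp_all
  then show "a = a'" using eq2 by metis
  then show "i = i'" using eq2 assms by simp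
qed

section \<open>Neighbourhoods and cycle lengths in the ring\<close>

lemma internal_cases:
  assumes "{u, w} \<in> ring_graph" "m \<le> u"
  obtains i a b where "i < m" "a < t" "0 < b" "b < l" "u = seg i a b"
proof -
  obtain i a b where iab: "i < m" "a < t" "b < l" "{u, w} = {seg i a b, seg i a (Suc b)}"
    using assms(1) unfolding ring_graph_def by auto
  then consider "u = seg i a b" | "u = seg i a (Suc b)" by (auto simp: doubleton_eq_iff)
  then show ?thesis
  proof cases
    case 1
    then have "b \<noteq> 0" using assms(2) iab seg_hub(1)[of i a] by (intro notI) simp
    then show ?thesis using that 1 iab by auto
  next
    case 2
    then have "Suc b \<noteq> l" using assms(2) seg_hub(2)[of i a] by (intro notI) simp
    then show ?thesis using that[of i a "Suc b"] 2 iab by auto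
  qed
qed

lemma internal_neighbours:
  assumes "{seg i a b, w} \<in> ring_graph" "a < t" "0 < b" "b < l"
  shows "w = seg i a (b - 1) \<or> w = seg i a (Suc b)"
proof -
  obtain i' a' b' where e: "i' < m" "a' < t" "b' < l"
      "{seg i a b, w} = {seg i' a' b', seg i' a' (Suc b')}"
    using assms(1) unfolding ring_graph_def by auto
  have ge: "m \<le> seg i a b" using assms seg_internal by simp
  consider "seg i a b = seg i' a' b'" "w = seg i' a' (Suc b')"
    | "seg i a b = seg i' a' (Suc b')" "w = seg i' a' b'"
    using e(4) by (auto simp: doubleton_eq_iff)
  then show ?thesis
  proof cases
    case 1
    then have "b' \<noteq> 0" using ge e seg_hub(1)[of i' a'] by (intro notI) simp
    then have "i = i'" "a = a'" "b = b'" using seg_eq[of b b' a a' i i'] assms e 1 by auto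
    then show ?thesis using 1 by simp
  next
    case 2
    then have "Suc b' \<noteq> l" using ge seg_hub(2)[of i' a'] by (intro notI) simp
    then have "i = i'" "a = a'" "b = Suc b'" using seg_eq[of b "Suc b'" a a' i i'] assms e 2 by auto
    then show ?thesis using 2 by simp
  qed
qed

text \<open>\<open>d\<close> is the direction of travel, so that a walk in either direction has
  increasing index \<open>b\<close>.\<close>

definition oseg :: "bool \<Rightarrow> nat \<Rightarrow> nat \<Rightarrow> nat \<Rightarrow> nat" where
  "oseg d i a b = (if d then seg i a b else seg i a (l - b))"

lemma hub_neighbours:
  assumes "{u, w} \<in> ring_graph" "u < m"
  shows "\<exists>d i a. i < m \<and> a < t \<and> u = oseg d i a 0 \<and> w = oseg d i a 1"
proof -
  obtain i a b where e: "i < m" "a < t" "b < l" "{u, w} = {seg i a b, seg i a (Suc b)}"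
    using assms(1) unfolding ring_graph_def by auto
  consider "u = seg i a b" "w = seg i a (Suc b)" | "u = seg i a (Suc b)" "w = seg i a b"
    using e(4) by (auto simp: doubleton_eq_iff)
  then show ?thesis
  proof cases
    case 1
    then have "b = 0" using seg_internal[of b i a] assms(2) e(3) by (cases "b = 0") auto
    then show ?thesis using 1 e
      by (intro exI[of _ True] exI[of _ i] exI[of _ a]) (simp add: oseg_def)
  next
    case 2
    then have "Suc b = l" using seg_internal[of "Suc b" i a] assms(2) e(3) by (cases "Suc b = l") auto
    then show ?thesis using 2 e
      by (intro exI[of _ False] exI[of _ i] exI[of _ a]) (auto simp: oseg_def)
  qed
qed

lemma oseg_internal: "0 < b \<Longrightarrow> b < l \<Longrightarrow> m \<le> oseg d i a b"
  by (simp add: oseg_def seg_internal)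

lemma oseg_neighbours:
  assumes "{oseg d i a b, w} \<in> ring_graph" "a < t" "0 < b" "b < l"
  shows "w = oseg d i a (b - 1) \<or> w = oseg d i a (Suc b)"
proof (cases d)
  case True
  then show ?thesis using assms internal_neighbours by (simp add: oseg_def)
next
  case False
  then have "w = seg i a (l - b - 1) \<or> w = seg i a (Suc (l - b))"
    using assms by (intro internal_neighbours) (auto simp: oseg_def)
  moreover have "l - b - 1 = l - Suc b" "Suc (l - b) = l - (b - 1)" using assms by auto
  ultimately show ?thesis using False by (auto simp: oseg_def)
qed

text \<open>\<open>g\<close> is a cycle of length \<open>K\<close> repeated periodically from a hub.
  As it never turns back, it traverses whole paths, and every \<open>l\<close>-th vertex is a hub.
  The hub walk \<open>h\<close> has period \<open>N = K / l\<close>; if \<open>N \<ge> 3\<close> it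
  cannot turn back either, so it goes round the ring and \<open>N = m\<close>.\<close>

lemma cyclic_walk_length:
  assumes eq: "\<And>i j. g i = g j \<longleftrightarrow> [i = j] (mod K)"
    and edge: "\<And>j. {g j, g (Suc j)} \<in> ring_graph" and "g 0 < m" "K \<ge> 3"
  shows "K = 2 * l \<or> K = m * l"
proof -
  have no_back: "g (Suc (Suc j)) \<noteq> g j" for j
  proof
    assume "g (Suc (Suc j)) = g j"
    then have "[j + 2 = j + 0] (mod K)" using eq by simp
    then have "[2 = 0] (mod K)" by (simp only: cong_add_lcancel_nat)
    then show False using \<open>K \<ge> 3\<close> by (simp add: cong_def)
  qed
  have traverse: "\<exists>d i a. i < m \<and> a < t \<and> (\<forall>b\<le>l. g (j + b) = oseg d i a b)" if j: "g j < m" for j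
  proof -
    obtain d i a where dia: "i < m" "a < t" "g j = oseg d i a 0" "g (Suc j) = oseg d i a 1"
      using hub_neighbours[OF edge j] by blast
    have "b < l \<longrightarrow> g (j + b) = oseg d i a b \<and> g (j + Suc b) = oseg d i a (Suc b)" for b
    proof (induction b)
      case 0
      then show ?case using dia by simp
    next
      case (Suc b)
      show ?case
      proof
        assume b: "Suc b < l"
        with Suc have IH: "g (j + b) = oseg d i a b" "g (j + Suc b) = oseg d i a (Suc b)" by auto
        have "{oseg d i a (Suc b), g (j + Suc (Suc b))} \<in> ring_graph"
          using edge[of "j + Suc b"] IH by simp
        from oseg_neighbours[OF this] have "g (j + Suc (Suc b)) = oseg d i a (Suc (Suc b))"
          using dia b IH no_back[of "j + b"] by auto
        then show "g (j + Suc b) = oseg d i a (Suc b) \<and>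
            g (j + Suc (Suc b)) = oseg d i a (Suc (Suc b))" using IH by simp
      qed
    qed
    then have "g (j + b) = oseg d i a b" if "b \<le> l" for b
      using that dia(3) by (cases b) auto
    then show ?thesis using dia by blast
  qed
  define h where "h q = g (q * l)" for q
  have next_hub: "h (Suc q) < m \<and> (h (Suc q) = Suc (h q) mod m \<or> h q = Suc (h (Suc q)) mod m)"
    if hq: "h q < m" for q
  proof -
    obtain d i a where dia: "i < m" "\<forall>b\<le>l. g (q * l + b) = oseg d i a b"
      using traverse[of "q * l"] hq unfolding h_def by blast
    have "h q = oseg d i a 0" "h (Suc q) = oseg d i a l"
      using dia(2)[rule_format, of 0] dia(2)[rule_format, of l] unfolding h_def
      by (simp_all add: add.commute)
    then show ?thesis using dia(1) l_ge_2 m_ge_2 by (cases d) (auto simp: oseg_def seg_def)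
  qed
  have hub: "h q < m" for q
    by (induction q) (use \<open>g 0 < m\<close> next_hub in \<open>auto simp: h_def\<close>)
  have step: "h (Suc q) = Suc (h q) mod m \<or> h q = Suc (h (Suc q)) mod m" for q
    using next_hub hub by blast
  have "l dvd K"
  \<comment> \<open>Otherwise \<open>g K\<close> would be internal to a path, although it equals the
    hub \<open>g 0\<close>.\<close>
  proof (rule ccontr)
    assume "\<not> l dvd K"
    then have b: "0 < K mod l" "K mod l < l" using l_ge_2 by (auto simp: dvd_eq_mod_eq_0)
    obtain d i a where "\<forall>b\<le>l. g (K div l * l + b) = oseg d i a b"
      using traverse[of "K div l * l"] hub unfolding h_def by blast
    then have "g (K div l * l + K mod l) = oseg d i a (K mod l)" using b(2) less_imp_le by blast
    then have "m \<le> g K" using oseg_internal[OF b] by simp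
    moreover have "g K = g 0" using eq by (simp add: cong_def)
    ultimately show False using \<open>g 0 < m\<close> by simp
  qed
  then obtain N where N: "K = N * l" by (auto simp: dvd_def mult.commute)
  have h_eq: "h p = h q \<longleftrightarrow> [p = q] (mod N)" for p q
    unfolding h_def eq N cong_def using l_ge_2 by (simp add: mult_mod_left flip: mod_mult_mult2)
  have "N \<noteq> 0" using N \<open>K \<ge> 3\<close> by (intro notI) simp
  have "N \<noteq> 1"
  proof
    assume "N = 1"
    then have "h (Suc 0) = h 0" using h_eq by (simp add: cong_def)
    then have "Suc (h 0) mod m = h 0" using step[of 0] by simp
    then show False using hub[of 0] m_ge_2 by (cases "Suc (h 0) = m") auto
  qed
  moreover have "N = m" if "N \<ge> 3"
  proof -
    have nb: "h (Suc (Suc q)) \<noteq> h q" for q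
    proof
      assume "h (Suc (Suc q)) = h q"
      then have "[q + 2 = q + 0] (mod N)" using h_eq by simp
      then have "[2 = 0] (mod N)" by (simp only: cong_add_lcancel_nat)
      then show False using that by (simp add: cong_def)
    qed
    have suc_inj: "u = v" if "Suc u mod m = Suc v mod m" "u < m" "v < m" for u v
      using that by (auto simp: mod_Suc split: if_splits)
    \<comment> \<open>In either direction \<open>N\<close> steps return to \<open>h 0\<close>, so
      \<open>m\<close> divides \<open>N\<close>; and \<open>m\<close> steps also return, so
      \<open>N\<close> divides \<open>m\<close>.\<close>
    have "[h 0 + m = h m] (mod m) \<and> [h 0 + N = h 0] (mod m) \<or>
          [h m + m = h 0] (mod m) \<and> [h 0 + N = h 0] (mod m)"
    proof (cases "h (Suc 0) = Suc (h 0) mod m")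
      case True
      have up: "h (Suc q) = Suc (h q) mod m" for q
      proof (induction q)
        case (Suc q)
        show ?case
        proof (rule ccontr)
          assume "\<not> ?case"
          then have "Suc (h q) mod m = Suc (h (Suc (Suc q))) mod m" using step[of "Suc q"] Suc by simp
          then show False using suc_inj hub nb by metis
        qed
      qed (rule True)
      have "[h 0 + q = h q] (mod m)" for q
      proof (induction q)
        case (Suc q)
        then have "Suc (h 0 + q) mod m = Suc (h q) mod m" unfolding cong_def by (metis mod_Suc_eq)
        then show ?case by (simp add: cong_def up)
      qed simp
      then have "[h 0 + m = h m] (mod m)" "[h 0 + N = h N] (mod m)" by blast+
      moreover have "h N = h 0" using h_eq by (simp add: cong_def)
      ultimately show ?thesis by simp
    next
      case False
      have down: "h q = Suc (h (Suc q)) mod m" for q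
      proof (induction q)
        case 0
        then show ?case using False step by blast
      next
        case (Suc q)
        show ?case
        proof (rule ccontr)
          assume "\<not> ?case"
          then have "h (Suc (Suc q)) = h q" using step[of "Suc q"] Suc by simp
          then show False using nb by blast
        qed
      qed
      have "[h q + q = h 0] (mod m)" for q
      proof (induction q)
        case (Suc q)
        have "[Suc (h (Suc q)) = h q] (mod m)" using down[of q] by (simp add: cong_def)
        then have "[Suc (h (Suc q)) + q = h q + q] (mod m)" by (simp only: cong_add_rcancel_nat)
        then show ?case using Suc cong_trans by fastforce
      qed simp
      then have "[h m + m = h 0] (mod m)" "[h N + N = h 0] (mod m)" by blast+
      moreover have "h N = h 0" using h_eq by (simp add: cong_def)
      ultimately show ?thesis by simp
    qed
    then have hm: "[h m = h 0] (mod m)" and "[h 0 + N = h 0 + 0] (mod m)"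
      by (auto simp: cong_def)
    then have "m dvd N" by (simp only: cong_add_lcancel_nat cong_0_iff)
    have "h m = h 0" using hm hub by (simp add: cong_def)
    then have "N dvd m" using h_eq by (simp add: cong_0_iff)
    then show "N = m" using \<open>m dvd N\<close> by (rule dvd_antisym)
  qed
  ultimately have "N = 2 \<or> N = m" using \<open>N \<noteq> 0\<close> by linarith
  then show ?thesis using N by auto
qed

text \<open>A cycle without hubs is impossible: from its largest vertex \<open>v = seg i a b\<close>
  it must use both neighbours, and \<open>seg i a (Suc b)\<close> is a hub or \<open>Suc v\<close>.
  So the cycle can be read from a hub.\<close>

lemma ring_cycle_length:
  assumes "contains_cycle ring_graph K"
  shows "K = 2 * l \<or> K = m * l"
proof -
  obtain f where K: "K \<ge> 3" and inj: "inj_on f {..<K}"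
    and edge: "\<And>i. i < K \<Longrightarrow> {f i, f (Suc i mod K)} \<in> ring_graph"
    using assms unfolding contains_cycle_def cycle_in_def by blast
  have edge': "{f (j mod K), f (Suc j mod K)} \<in> ring_graph" for j
    using edge[of "j mod K"] K by (simp add: mod_Suc_eq)
  have "\<exists>j<K. f j < m"
  proof (rule ccontr)
    assume "\<not> ?thesis"
    then have ge: "m \<le> f j" if "j < K" for j using that by (meson not_le)
    define v where "v = Max (f ` {..<K})"
    have "v \<in> f ` {..<K}" unfolding v_def using K by (intro Max_in) (auto simp: lessThan_empty_iff)
    then obtain j where j: "j < K" "f j = v" by auto
    obtain i a b where iab: "i < m" "a < t" "0 < b" "b < l" "v = seg i a b"
      using internal_cases[OF edge[OF j(1)] ge[OF j(1)]] j(2) by metis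
    have "Suc (j + K - 1) mod K = j" using j K by simp
    then have "{v, f ((j + K - 1) mod K)} \<in> ring_graph" "{v, f (Suc j mod K)} \<in> ring_graph"
      using edge'[of "j + K - 1"] edge[OF j(1)] j(2) by (simp_all add: insert_commute)
    then have "f ((j + K - 1) mod K) \<in> {seg i a (b - 1), seg i a (Suc b)}"
      "f (Suc j mod K) \<in> {seg i a (b - 1), seg i a (Suc b)}"
      using internal_neighbours iab by auto
    moreover have "f ((j + K - 1) mod K) \<noteq> f (Suc j mod K)"
    proof
      assume "f ((j + K - 1) mod K) = f (Suc j mod K)"
      then have "(j + K - 1) mod K = Suc j mod K" using inj K by (auto simp: inj_on_def)
      then have "[j + (K - 1) = j + 1] (mod K)" using K by (simp add: cong_def)
      then have "[K - 1 = 1] (mod K)" by (simp only: cong_add_lcancel_nat)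
      then show False using K by (simp add: cong_def)
    qed
    ultimately obtain j' where j': "j' < K" "f j' = seg i a (Suc b)"
      using K by (metis insert_iff mod_less_divisor not_gr_zero not_less_zero singletonD
          zero_less_numeral less_le_trans)
    then have "Suc b \<noteq> l" using ge[OF j'(1)] seg_hub(2)[of i a] by auto
    then have "seg i a (Suc b) = Suc (seg i a b)" using iab(3,4) by (cases b) (simp_all add: seg_def)
    then have "f j' = Suc v" using j'(2) iab(5) by (simp only:)
    moreover have "f j' \<le> v" unfolding v_def using j'(1) by (intro Max_ge) blast+
    ultimately show False by simp
  qed
  then obtain j0 where j0: "j0 < K" "f j0 < m" by blast
  define g where "g j = f ((j0 + j) mod K)" for j
  show ?thesis
  proof (rule cyclic_walk_length[of g])
    fix i j
    have "g i = g j \<longleftrightarrow> (j0 + i) mod K = (j0 + j) mod K"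
      unfolding g_def using inj K by (auto simp: inj_on_def)
    also have "\<dots> \<longleftrightarrow> [j0 + i = j0 + j] (mod K)" by (simp add: cong_def)
    also have "\<dots> \<longleftrightarrow> [i = j] (mod K)" by (simp only: cong_add_lcancel_nat)
    finally show "g i = g j \<longleftrightarrow> [i = j] (mod K)" .
    show "{g j, g (Suc j)} \<in> ring_graph" unfolding g_def using edge'[of "j0 + j"] by simp
  qed (use j0 K in \<open>auto simp: g_def\<close>)
qed

section \<open>Size of the ring and its cycles of length \<open>m * l\<close>\<close>

lemma seg_less:
  assumes "i < m" "a < t" "b \<le> l"
  shows "seg i a b < m + m * t * (l - 1)"
proof (cases "b = 0 \<or> b = l")
  case True
  then show ?thesis using seg_hub[of i a] assms by (auto intro: less_le_trans)
next
  case False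
  then have "b - 1 < l - 1" using assms by auto
  have "(i * t + a) * (l - 1) + (b - 1) < Suc (i * t + a) * (l - 1)" using \<open>b - 1 < l - 1\<close> by simp
  also have "\<dots> \<le> Suc i * t * (l - 1)" using assms(2) by (intro mult_le_mono1) simp
  also have "\<dots> \<le> m * t * (l - 1)" using assms(1) by (intro mult_le_mono1) simp
  finally show ?thesis using False by (simp add: seg_def)
qed

lemma simple_ring_graph:
  assumes "m + m * t * (l - 1) \<le> n"
  shows "simple_graph n ring_graph"
proof -
  have "seg i a b \<noteq> seg i a (Suc b)" if "i < m" "a < t" "b < l" for i a b
  proof (cases "b = 0")
    case True
    then show ?thesis using that seg_hub(1)[of i a] seg_internal[of 1 i a] l_ge_2 by auto
  next
    case False
    then have "m \<le> seg i a b" using that seg_internal by simp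
    show ?thesis
    proof (cases "Suc b = l")
      case True
      then show ?thesis using \<open>m \<le> seg i a b\<close> seg_hub(2)[of i a] by auto
    next
      case False
      then show ?thesis using seg_eq(3)[of b "Suc b" a a i i] that \<open>b \<noteq> 0\<close> by auto
    qed
  qed
  moreover have "seg i a b < n" if "i < m" "a < t" "b \<le> l" for i a b
    using seg_less[OF that] assms by simp
  ultimately have "\<exists>u v. {seg i a b, seg i a (Suc b)} = {u, v} \<and> u \<noteq> v \<and> u < n \<and> v < n"
    if "i < m" "a < t" "b < l" for i a b
    using that by (intro exI[of _ "seg i a b"] exI[of _ "seg i a (Suc b)"]) simp
  then show ?thesis unfolding simple_graph_def ring_graph_def by blast
qed

definition lap :: "(nat \<Rightarrow> nat) \<Rightarrow> nat \<Rightarrow> nat" where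
  "lap c j = seg (j div l) (c (j div l)) (j mod l)"

lemma lap_cycle:
  assumes c: "c \<in> {..<m} \<rightarrow>\<^sub>E {..<t}"
  shows "cycle_in ring_graph (m * l) (lap c)"
  unfolding cycle_in_def
proof (intro conjI allI impI)
  have "2 * 2 \<le> m * l" using l_ge_2 m_ge_2 by (intro mult_le_mono)
  then show "3 \<le> m * l" by simp
  have div_lt: "j div l < m" if "j < m * l" for j using that by (simp add: less_mult_imp_div_less)
  have ct: "c i < t" if "i < m" for i using c that by auto
  have mod_lt: "j mod l < l" for j using l_ge_2 by simp
  show "inj_on (lap c) {..<m * l}"
  proof (rule inj_onI)
    fix j j' assume "j \<in> {..<m * l}" "j' \<in> {..<m * l}" and eq: "lap c j = lap c j'"
    then have lt: "j div l < m" "j' div l < m" using div_lt by auto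
    have hubs: "j mod l = 0 \<longleftrightarrow> lap c j < m" if "j div l < m" for j
      using seg_hub(1)[OF that] seg_internal[of "j mod l"] mod_lt[of j] unfolding lap_def
      by (metis gr0I not_le)
    have "j div l = j' div l \<and> j mod l = j' mod l"
    proof (cases "j mod l = 0")
      case True
      then have "j' mod l = 0" using hubs lt eq by simp
      then show ?thesis using True eq by (simp add: lap_def seg_def)
    next
      case False
      then have "j' mod l \<noteq> 0" using hubs lt eq by simp
      then show ?thesis using False eq mod_lt ct lt unfolding lap_def
        by (metis seg_eq(1) seg_eq(3) gr0I)
    qed
    then show "j = j'" by (metis div_mult_mod_eq)
  qed
  fix j assume j: "j < m * l"
  let ?i = "j div l" and ?b = "j mod l"
  have mem: "{seg ?i (c ?i) ?b, seg ?i (c ?i) (Suc ?b)} \<in> ring_graph"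
    unfolding ring_graph_def using div_lt[OF j] ct mod_lt by blast
  have "lap c (Suc j mod (m * l)) = seg ?i (c ?i) (Suc ?b)"
  proof (cases "Suc ?b = l")
    case True
    have "Suc j = ?i * l + Suc ?b" by simp
    then have "Suc j = Suc ?i * l" using True by simp
    then have "Suc j mod (m * l) = (Suc ?i mod m) * l" by (simp only: mult_mod_left)
    then have "lap c (Suc j mod (m * l)) = lap c ((Suc ?i mod m) * l)" by (simp only:)
    also have "\<dots> = Suc ?i mod m" using l_ge_2 by (simp add: lap_def seg_def)
    also have "\<dots> = seg ?i (c ?i) (Suc ?b)" using True l_ge_2 by (simp add: seg_def)
    finally show ?thesis .
  next
    case False
    then have S: "Suc j div l = ?i" "Suc j mod l = Suc ?b" using mod_lt[of j]
      by (auto simp: div_Suc mod_Suc)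
    have "Suc j \<noteq> m * l"
    proof
      assume "Suc j = m * l"
      then have "Suc j mod l = 0" by simp
      then show False using S by simp
    qed
    then have "Suc j mod (m * l) = Suc j" using j by simp
    then show ?thesis using S by (simp add: lap_def)
  qed
  then show "{lap c j, lap c (Suc j mod (m * l))} \<in> ring_graph" using mem by (simp add: lap_def)
qed

text \<open>The edges determine the vertex set, which contains the first vertex after each hub
  \<open>i\<close>. As \<open>l \<ge> 2\<close>, that vertex is internal and encodes
  \<open>i\<close> and \<open>c i\<close>.\<close>

lemma inj_lap_edges: "inj_on (\<lambda>c. cycle_edges (m * l) (lap c)) ({..<m} \<rightarrow>\<^sub>E {..<t})"
proof (rule inj_onI)
  fix c c' assume c: "c \<in> {..<m} \<rightarrow>\<^sub>E {..<t}" and c': "c' \<in> {..<m} \<rightarrow>\<^sub>E {..<t}"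
    and eq: "cycle_edges (m * l) (lap c) = cycle_edges (m * l) (lap c')"
  have "m * l > 0" using l_ge_2 m_ge_2 by simp
  then have im: "lap c ` {..<m * l} = lap c' ` {..<m * l}"
    using eq Union_cycle_edges by metis
  show "c = c'"
  proof (rule PiE_ext[OF c c'])
    fix i assume "i \<in> {..<m}"
    then have i: "i < m" by simp
    have "Suc i * l \<le> m * l" using i by (intro mult_le_mono1) simp
    then have "1 + i * l < m * l" using l_ge_2 by simp
    then have "lap c (1 + i * l) \<in> lap c' ` {..<m * l}" using im by blast
    then obtain j where j: "j < m * l" "lap c (1 + i * l) = lap c' j" by auto
    have "(1 + i * l) div l = i" "(1 + i * l) mod l = 1"
      using l_ge_2 by (simp_all only: div_mult_self1 mod_mult_self1) simp_all
    then have e: "seg i (c i) 1 = seg (j div l) (c' (j div l)) (j mod l)"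
      using j(2) unfolding lap_def by simp
    have jm: "j div l < m" using j(1) by (simp add: less_mult_imp_div_less)
    have "m \<le> seg i (c i) 1" using seg_internal l_ge_2 by simp
    then have "j mod l \<noteq> 0" using e seg_hub(1)[OF jm, of "c' (j div l)"] by (intro notI) simp
    moreover have "j mod l < l" "c i < t" "c' (j div l) < t" using l_ge_2 c c' i jm by auto
    ultimately show "c i = c' i"
      using seg_eq(1,2)[of 1 "j mod l" "c i" "c' (j div l)" i "j div l"] e l_ge_2 by simp
  qed
qed

lemma num_cycles_ring_graph: "t ^ m \<le> num_cycles ring_graph (m * l)"
proof -
  have "t ^ m = card ({..<m} \<rightarrow>\<^sub>E {..<t})" by (simp add: card_PiE)
  also have "\<dots> \<le> card {cycle_edges (m * l) f | f. cycle_in ring_graph (m * l) f}"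
    using finite_cycles[OF finite_simple_graph[OF simple_ring_graph[OF order_refl]]] lap_cycle
    by (intro card_inj_on_le[OF inj_lap_edges]) auto
  finally show ?thesis unfolding num_cycles_def .
qed

end

subsection \<open>Asymptotics\<close>

text \<open>What makes the \<open>Max\<close> in \<open>ex_cycles\<close> meaningful; the empty
  graph supplies a member.\<close>

lemma ex_cycles_set:
  "finite {num_cycles G k | G. simple_graph n G \<and> (\<forall>j\<in>F. \<not> contains_cycle G j)}"
  "{num_cycles G k | G. simple_graph n G \<and> (\<forall>j\<in>F. \<not> contains_cycle G j)} \<noteq> {}"
proof -
  let ?E = "{{u, v} | u v. u \<noteq> v \<and> u < n \<and> v < n}"
  have "finite ?E" by (rule finite_subset[of _ "Pow {..<n}"]) auto
  then have "finite ((\<lambda>G. num_cycles G k) ` Pow ?E)" by simp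
  then show "finite {num_cycles G k | G. simple_graph n G \<and> (\<forall>j\<in>F. \<not> contains_cycle G j)}"
    by (rule rev_finite_subset) (auto simp: simple_graph_def)
  have "simple_graph n {} \<and> (\<forall>j\<in>F. \<not> contains_cycle {} j)"
    by (auto simp: simple_graph_def contains_cycle_def cycle_in_def intro!: exI[of _ 0])
  then show "{num_cycles G k | G. simple_graph n G \<and> (\<forall>j\<in>F. \<not> contains_cycle G j)} \<noteq> {}"
    by blast
qed

lemma ex_cycles_upper:
  assumes "l \<ge> 2" "k > l" "m \<ge> 2"
  shows "ex_cycles n (m * l) ({3..2 * l - 1} \<union> {2 * k})
    \<le> (2 * (1 + 4 * k) * (2 * k + 1) + 4 * k\<^sup>2) ^ m * n ^ m"
proof -
  have "num_cycles G (m * l) \<le> (2 * (1 + 4 * k) * (2 * k + 1) + 4 * k\<^sup>2) ^ m * n ^ m"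
    if G: "simple_graph n G" "\<forall>j\<in>{3..2 * l - 1} \<union> {2 * k}. \<not> contains_cycle G j" for G
  proof -
    interpret even_cycle_free_graph G n l k
      by unfold_locales (use assms G in auto)
    show ?thesis by (rule num_cycles_upper[OF assms(3)])
  qed
  then show ?thesis
    unfolding ex_cycles_def
    by (intro Max.boundedI[OF ex_cycles_set]) (elim CollectE exE conjE, simp)
qed

lemma ex_cycles_lower:
  assumes "l \<ge> 2" "k > l" "m \<ge> 2" "2 * k \<noteq> m * l" "m + m * t * (l - 1) \<le> n"
  shows "t ^ m \<le> ex_cycles n (m * l) ({3..2 * l - 1} \<union> {2 * k})"
proof -
  interpret theta_ring l m t by unfold_locales (use assms in auto)
  \<comment> \<open>The lengths up to \<open>2 * l - 1\<close> lie below both cycle lengths of the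
    ring, and \<open>2 * k\<close> differs from \<open>2 * l\<close> because
    \<open>k > l\<close>.\<close>
  have "2 * l \<le> m * l" using assms(3) by (intro mult_le_mono1)
  then have "j \<noteq> 2 * l \<and> j \<noteq> m * l" if "j \<in> {3..2 * l - 1} \<union> {2 * k}" for j
    using that assms(1,2,4) unfolding Un_iff atLeastAtMost_iff singleton_iff by linarith
  then have "\<not> contains_cycle ring_graph j" if "j \<in> {3..2 * l - 1} \<union> {2 * k}" for j
    using that ring_cycle_length by blast
  then have "num_cycles ring_graph (m * l) \<le> ex_cycles n (m * l) ({3..2 * l - 1} \<union> {2 * k})"
    unfolding ex_cycles_def using simple_ring_graph[OF assms(5)]
    by (intro Max_ge[OF ex_cycles_set(1)]) blast
  then show ?thesis using num_cycles_ring_graph by linarith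
qed

theorem theorem11:
  fixes l k m :: nat
  assumes "l \<ge> 2" and "k > l" and "m \<ge> 2" and "2 * k \<noteq> m * l"
  shows "(\<lambda>n. real (ex_cycles n (m * l) ({3..2 * l - 1} \<union> {2 * k})))
           \<in> \<Theta>(\<lambda>n. real n ^ m)"
proof (rule bigthetaI')
  let ?C = "2 * (1 + 4 * k) * (2 * k + 1) + 4 * k\<^sup>2"
  let ?ex = "\<lambda>n. ex_cycles n (m * l) ({3..2 * l - 1} \<union> {2 * k})"
  have pos: "m * l > 0" using assms by simp
  show "0 < (1 / real (4 * m * l)) ^ m" using pos by simp
  have "0 < ?C" by simp
  then show "0 < real ?C ^ m" by (simp only: of_nat_0_less_iff zero_less_power)
  have "(1 / real (4 * m * l)) ^ m * norm (real n ^ m) \<le> norm (real (?ex n)) \<and>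
      norm (real (?ex n)) \<le> real ?C ^ m * norm (real n ^ m)" if n: "n \<ge> 4 * m * l" for n
  proof
    \<comment> \<open>The paths take at most \<open>n / 2\<close> vertices, leaving room for the
      hubs. As \<open>n \<ge> 4 * m * l\<close>, rounding down costs at most a factor 2, which gives
      the constant \<open>4 * m * l\<close>.\<close>
    define t where "t = n div (2 * m * l)"
    have "2 * m * l * t \<le> n" unfolding t_def by (rule times_div_less_eq_dividend)
    moreover have "m * t * (l - 1) \<le> m * l * t" by (simp add: mult.assoc mult.commute)
    moreover have "m * 1 \<le> m * l" using assms by (intro mult_le_mono2) simp
    ultimately have "m + m * t * (l - 1) \<le> n" using n by linarith
    from ex_cycles_lower[OF assms this] have lower: "t ^ m \<le> ?ex n" .
    have "n < 2 * m * l * (t + 1)"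
      unfolding t_def using pos dividend_less_times_div[of "2 * m * l" n] by simp
    then have "n \<le> 4 * m * l * t" using n by (simp add: algebra_simps)
    then have "real n \<le> real (4 * m * l) * real t" by (metis of_nat_le_iff of_nat_mult)
    then have "1 / real (4 * m * l) * real n \<le> real t" using pos by (simp add: field_simps)
    then have "(1 / real (4 * m * l) * real n) ^ m \<le> real t ^ m" by (intro power_mono) auto
    also have "\<dots> \<le> real (?ex n)" using lower by (metis of_nat_le_iff of_nat_power)
    finally show "(1 / real (4 * m * l)) ^ m * norm (real n ^ m) \<le> norm (real (?ex n))"
      by (simp only: power_mult_distrib real_norm_def abs_of_nonneg of_nat_0_le_iff zero_le_power)
    have "real (?ex n) \<le> real (?C ^ m * n ^ m)"
      using ex_cycles_upper[OF assms(1-3)] by (simp only: of_nat_le_iff)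
    then show "norm (real (?ex n)) \<le> real ?C ^ m * norm (real n ^ m)"
      by (simp only: of_nat_mult of_nat_power real_norm_def abs_of_nonneg of_nat_0_le_iff zero_le_power)
  qed
  then show "\<forall>\<^sub>F n in at_top. (1 / real (4 * m * l)) ^ m * norm (real n ^ m) \<le> norm (real (?ex n)) \<and>
      norm (real (?ex n)) \<le> real ?C ^ m * norm (real n ^ m)"
    by (rule eventually_at_top_linorderI)
qed

end
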